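(* Let $w=w_0w_1\cdots w_n$ be a binary rotation word of length $n+1$ containing at least two occurrences of $1$ and at least two occurrences of $0$, and suppose that $w$ is generated by at least two different pairs of Sturmian words of slope less than $1/2$. Then $w=0^i(10^l)^k10^j$ or $w=1^i(01^l)^k01^j$ for some integers $i,j\ge 0$, $l\ge 2$, $k\ge 1$, and the number of pairs of Sturmian words of slope less than $1/2$ generating $w$ equals $\varphi(l+1)/2$ if $i\le l$ and $j\le l$, and equals $\varphi(l+1)$ otherwise.
   Context: For $\alpha,\beta,\gamma\in[0,1)$, the rotation word $r(\alpha,\beta,\gamma,n)=r_0\cdots r_{n-1}$ is defined by $r_i=1$ if $\{i\alpha\}\in[\beta,\gamma)$ and $r_i=0$ otherwise, where $[\beta,\gamma)$ is the usual interval if $\beta<\gamma$ and $[\beta,1)\cup[0,\gamma)$ otherwise; a binary rotation word is any word of this form. For $\alpha\in(0,1)$, let $St(n,\alpha)=\{r(\alpha,\beta,\beta+\alpha \bmod 1,n):\beta\in[0,1)\}$ be the set of Sturmian words of length $n$ and slope $\alpha$. A pair $(u,v)$ of binary words $u=u_1\cdots u_n$, $v=v_1\cdots v_n$ is a pair of Sturmian words of slope less than $1/2$ if $u,v\in St(n,\alpha)$ for some $\alpha\in(0,1/2)$. Such a pair generates the binary word $w=w_0\cdots w_n$ if $w_k=w_{k-1}+u_k-v_k$ for all $k=1,\dots,n$. Pairs are counted as ordered pairs of words (regardless of how many slopes they share). $\varphi$ is Euler's totient function. *)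

theory Defs
  imports Complex_Main "HOL-Number_Theory.Totient"
begin

(* Words are lists of integers, so that w_(k-1) + u_k - v_k is not truncated. *)

definition binary_word :: "int list \<Rightarrow> bool" where
  "binary_word w \<longleftrightarrow> set w \<subseteq> {0, 1}"

(* For b = c this is the whole circle [0,1). *)
definition circle_interval :: "real \<Rightarrow> real \<Rightarrow> real set" where
  "circle_interval b c = (if b < c then {b..<c} else {b..<1} \<union> {0..<c})"

definition rotation_word :: "real \<Rightarrow> real \<Rightarrow> real \<Rightarrow> nat \<Rightarrow> int list" where
  "rotation_word \<alpha> \<beta> \<gamma> n =
     map (\<lambda>i. if frac (real i * \<alpha>) \<in> circle_interval \<beta> \<gamma> then 1 else 0) [0..<n]"

definition binary_rotation_word :: "int list \<Rightarrow> bool" where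
  "binary_rotation_word w \<longleftrightarrow>
     (\<exists>\<alpha>\<in>{0..<1}. \<exists>\<beta>\<in>{0..<1}. \<exists>\<gamma>\<in>{0..<1}. \<exists>n. w = rotation_word \<alpha> \<beta> \<gamma> n)"

definition St :: "nat \<Rightarrow> real \<Rightarrow> int list set" where
  "St n \<alpha> = {rotation_word \<alpha> \<beta> (frac (\<beta> + \<alpha>)) n | \<beta>. \<beta> \<in> {0..<1}}"

definition sturmian_pairs :: "nat \<Rightarrow> (int list \<times> int list) set" where
  "sturmian_pairs n = {(u, v). \<exists>\<alpha>. 0 < \<alpha> \<and> \<alpha> < 1/2 \<and> u \<in> St n \<alpha> \<and> v \<in> St n \<alpha>}"

(* u and v are indexed from 1 in the mathematical notation, w from 0. *)
definition generates :: "nat \<Rightarrow> int list \<times> int list \<Rightarrow> int list \<Rightarrow> bool" where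
  "generates n p w \<longleftrightarrow> (case p of (u, v) \<Rightarrow>
     length u = n \<and> length v = n \<and> length w = n + 1 \<and> binary_word w \<and>
     (\<forall>k\<in>{1..n}. w ! k = w ! (k - 1) + u ! (k - 1) - v ! (k - 1)))"

definition generating_pairs :: "nat \<Rightarrow> int list \<Rightarrow> (int list \<times> int list) set" where
  "generating_pairs n w = {p \<in> sturmian_pairs n. generates n p w}"

definition word_power :: "int list \<Rightarrow> nat \<Rightarrow> int list" where
  "word_power x k = concat (replicate k x)"

end

theory Submission
  imports Defs
begin

text \<open>
  Up to an additive constant, the prefix sums of a Sturmian word of slope \<open>\<alpha>\<close> are
  \<open>k \<mapsto> \<lfloor>k \<alpha> + \<rho>\<rfloor>\<close>. A generating pair thus amounts to \<open>\<alpha>, \<rho>, \<sigma>\<close> with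
  \<open>w\<^sub>k = \<lfloor>k \<alpha> + \<rho>\<rfloor> - \<lfloor>k \<alpha> + \<sigma>\<rfloor>\<close>: the letter \<open>1\<close> marks the visits of a rotation orbit to an arc,
  and the pair records in addition how often the orbit jumps over that arc.

  If both \<open>00\<close> and \<open>11\<close> occur in \<open>w\<close>, a slope below \<open>1/2\<close> forbids such jumps and the pair is unique; so, after
  complementing \<open>w\<close> (which swaps \<open>u\<close> and \<open>v\<close>), assume that \<open>11\<close> does not occur. If two consecutive \<open>1\<close>s
  are at distance \<open>q\<close> and the orbit makes \<open>p\<close> turns in between, then \<open>p\<close> and \<open>q\<close> are coprime, \<open>2 p \<le> q\<close>, and
  the number of turns up to step \<open>k < q\<close> is determined by \<open>\<lfloor>k p / q\<rfloor>\<close>. Two different distances \<open>q, q'\<close>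
  satisfy \<open>\<bar>q p' - p q'\<bar> = 1\<close>, which determines \<open>p\<close> and \<open>p'\<close>; the pair is again unique.
  So all distances equal some \<open>q = l + 1\<close>. Then \<open>p\<close> is arbitrary among the \<open>\<phi>(q)/2\<close> residues prime to \<open>q\<close>
  and below \<open>q/2\<close>, and the only further freedom is the direction in which the orbit drifts through
  the arc, which is visible exactly if \<open>i \<ge> q\<close> or \<open>j \<ge> q\<close>.
\<close>

section \<open>Inequalities for the prefix sums of a generating pair\<close>

text \<open>The second word of the pair has the prefix sums \<open>U - W\<close>, so \<open>U\<close> alone represents the pair.\<close>

definition crossings :: "nat \<Rightarrow> (nat \<Rightarrow> int) \<Rightarrow> (nat \<Rightarrow> int) \<Rightarrow> bool" where
  "crossings n W U \<longleftrightarrow> (\<exists>\<alpha> \<rho> \<sigma>. 0 < \<alpha> \<and> \<alpha> < 1/2 \<and>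
     (\<forall>k\<le>n. U k = \<lfloor>real k * \<alpha> + \<rho>\<rfloor> \<and> U k - W k = \<lfloor>real k * \<alpha> + \<sigma>\<rfloor>))"

text \<open>Taking differences forgets the additive constant of \<open>U\<close>, which the pair of
  words does not determine.\<close>

definition increments :: "nat \<Rightarrow> (nat \<Rightarrow> int) \<Rightarrow> int list" where
  "increments n U = map (\<lambda>k. U (Suc k) - U k) [0..<n]"

lemma crossingsE:
  assumes "crossings n W U"
  obtains \<alpha> \<rho> \<sigma> :: real where "0 < \<alpha>" "\<alpha> < 1/2"
    "\<And>k. k \<le> n \<Longrightarrow> of_int (U k) \<le> k * \<alpha> + \<rho>" "\<And>k. k \<le> n \<Longrightarrow> k * \<alpha> + \<rho> < of_int (U k) + 1"
    "\<And>k. k \<le> n \<Longrightarrow> of_int (U k) - of_int (W k) \<le> k * \<alpha> + \<sigma>"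
    "\<And>k. k \<le> n \<Longrightarrow> k * \<alpha> + \<sigma> < of_int (U k) - of_int (W k) + 1"
proof -
  from assms obtain \<alpha> \<rho> \<sigma> :: real where a: "0 < \<alpha>" "\<alpha> < 1/2"
    and f: "\<And>k. k \<le> n \<Longrightarrow> \<lfloor>real k * \<alpha> + \<rho>\<rfloor> = U k"
           "\<And>k. k \<le> n \<Longrightarrow> \<lfloor>real k * \<alpha> + \<sigma>\<rfloor> = U k - W k"
    unfolding crossings_def by metis
  show ?thesis
    by (rule that[OF a]) (use f in \<open>auto simp: floor_eq_iff\<close>)
qed

text \<open>Estimate \<open>s\<close>, \<open>t\<close> through \<open>\<sigma>\<close> and
  \<open>s'\<close>, \<open>t'\<close> through \<open>\<rho>\<close>, then the other way round.
  Knowing the four letters saves one unit over the usual balance estimate, so equal displacements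
  from arc to arc and from complement to complement make the same number of turns.\<close>

lemma crossings_parallelogram:
  assumes "crossings n W U" and "s \<le> n" "s' \<le> n" "t \<le> n" "t' \<le> n" "s' + t = s + t'"
    and "W s = 1" "W s' = 1" "W t = 0" "W t' = 0"
  shows "U s' - U s = U t' - U t"
proof -
  from assms(1) obtain \<alpha> \<rho> \<sigma> :: real where
    *: "\<And>k. k \<le> n \<Longrightarrow> of_int (U k) \<le> k * \<alpha> + \<rho>" "\<And>k. k \<le> n \<Longrightarrow> k * \<alpha> + \<rho> < of_int (U k) + 1"
    "\<And>k. k \<le> n \<Longrightarrow> of_int (U k) - of_int (W k) \<le> k * \<alpha> + \<sigma>"
    "\<And>k. k \<le> n \<Longrightarrow> k * \<alpha> + \<sigma> < of_int (U k) - of_int (W k) + 1"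
    using crossingsE by metis
  have "(real s' + real t) * \<alpha> = (real s + real t') * \<alpha>"
    using assms(6) by (metis of_nat_add)
  then have e: "s' * \<alpha> + t * \<alpha> = s * \<alpha> + t' * \<alpha>" by (simp add: algebra_simps)
  note b = *[OF assms(2)] *[OF assms(3)] *[OF assms(4)] *[OF assms(5)]
  have "real_of_int (U s' - U s) < real_of_int (U t' - U t + 1)"
    using b e assms(7-10) by simp
  moreover have "real_of_int (U t' - U t) < real_of_int (U s' - U s + 1)"
    using b e assms(7-10) by simp
  ultimately show ?thesis unfolding of_int_less_iff by simp
qed

text \<open>All floors involved have the same slope, so over stretches of equal length their
  increments differ by less than two. This applies across the two words of the pair as well as
  within each.\<close>

lemma crossings_balanced:
  assumes "crossings n W U" and "s + d \<le> n" "t + d \<le> n"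
  shows "\<bar>(U (s + d) - U s) - (U (t + d) - U t)\<bar> \<le> 1"
    and "\<bar>(U (s + d) - U s) - ((U (t + d) - W (t + d)) - (U t - W t))\<bar> \<le> 1"
    and "\<bar>((U (s + d) - W (s + d)) - (U s - W s)) - ((U (t + d) - W (t + d)) - (U t - W t))\<bar> \<le> 1"
proof -
  from assms(1) obtain \<alpha> \<rho> \<sigma> :: real where
    *: "\<And>k. k \<le> n \<Longrightarrow> of_int (U k) \<le> k * \<alpha> + \<rho>" "\<And>k. k \<le> n \<Longrightarrow> k * \<alpha> + \<rho> < of_int (U k) + 1"
    "\<And>k. k \<le> n \<Longrightarrow> of_int (U k) - of_int (W k) \<le> k * \<alpha> + \<sigma>"
    "\<And>k. k \<le> n \<Longrightarrow> k * \<alpha> + \<sigma> < of_int (U k) - of_int (W k) + 1"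
    using crossingsE by metis
  have l: "s \<le> n" "t \<le> n" using assms by auto
  note b = *[OF assms(2)] *[OF assms(3)] *[OF l(1)] *[OF l(2)]
  have e: "(s + d) * \<alpha> = s * \<alpha> + d * \<alpha>" "(t + d) * \<alpha> = t * \<alpha> + d * \<alpha>"
    by (simp_all add: algebra_simps)
  have "real_of_int (U (s + d) - U s) < real_of_int ((U (t + d) - U t) + 2)"
       "real_of_int (U (t + d) - U t) < real_of_int ((U (s + d) - U s) + 2)"
    using b unfolding e by simp_all
  then show "\<bar>(U (s + d) - U s) - (U (t + d) - U t)\<bar> \<le> 1"
    unfolding of_int_less_iff by simp
  have "real_of_int (U (s + d) - U s) < real_of_int (((U (t + d) - W (t + d)) - (U t - W t)) + 2)"
       "real_of_int ((U (t + d) - W (t + d)) - (U t - W t)) < real_of_int ((U (s + d) - U s) + 2)"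
    using b unfolding e by simp_all
  then show "\<bar>(U (s + d) - U s) - ((U (t + d) - W (t + d)) - (U t - W t))\<bar> \<le> 1"
    unfolding of_int_less_iff by simp
  have "real_of_int ((U (s + d) - W (s + d)) - (U s - W s)) < real_of_int (((U (t + d) - W (t + d)) - (U t - W t)) + 2)"
       "real_of_int ((U (t + d) - W (t + d)) - (U t - W t)) < real_of_int (((U (s + d) - W (s + d)) - (U s - W s)) + 2)"
    using b unfolding e by simp_all
  then show "\<bar>((U (s + d) - W (s + d)) - (U s - W s)) - ((U (t + d) - W (t + d)) - (U t - W t))\<bar> \<le> 1"
    unfolding of_int_less_iff by simp
qed

lemma crossings_step:
  assumes "crossings n W U" "k < n"
  shows "U (Suc k) - U k \<in> {0, 1}" and "(U (Suc k) - W (Suc k)) - (U k - W k) \<in> {0, 1}"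
proof -
  from assms(1) obtain \<alpha> \<rho> \<sigma> :: real where a: "0 < \<alpha>" "\<alpha> < 1/2" and
    *: "\<And>k. k \<le> n \<Longrightarrow> of_int (U k) \<le> k * \<alpha> + \<rho>" "\<And>k. k \<le> n \<Longrightarrow> k * \<alpha> + \<rho> < of_int (U k) + 1"
    "\<And>k. k \<le> n \<Longrightarrow> of_int (U k) - of_int (W k) \<le> k * \<alpha> + \<sigma>"
    "\<And>k. k \<le> n \<Longrightarrow> k * \<alpha> + \<sigma> < of_int (U k) - of_int (W k) + 1"
    using crossingsE by metis
  have l: "k \<le> n" "Suc k \<le> n" using assms by auto
  note b = *[OF l(1)] *[OF l(2)]
  have e: "Suc k * \<alpha> = k * \<alpha> + \<alpha>" by (simp add: algebra_simps)
  have "real_of_int (U (Suc k) - U k) < of_int 2" "real_of_int (- 1) < real_of_int (U (Suc k) - U k)"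
    using b a unfolding e by simp_all
  then show "U (Suc k) - U k \<in> {0, 1}" unfolding of_int_less_iff by auto
  have "real_of_int ((U (Suc k) - W (Suc k)) - (U k - W k)) < of_int 2"
    "real_of_int (- 1) < real_of_int ((U (Suc k) - W (Suc k)) - (U k - W k))"
    using b a unfolding e by simp_all
  then show "(U (Suc k) - W (Suc k)) - (U k - W k) \<in> {0, 1}" unfolding of_int_less_iff by auto
qed

text \<open>Here \<open>\<alpha> < 1/2\<close> excludes a full turn in two steps. For the second
  claim, \<open>k * \<alpha> + \<sigma>\<close> is below \<open>U k\<close> because of the
  \<open>1\<close>, so it stays below \<open>U k + 1\<close> after two steps, and the final
  \<open>0\<close> bounds \<open>U (k + 2)\<close> by it.\<close>

lemma crossings_two_steps:
  assumes "crossings n W U" "k + 2 \<le> n"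
  shows "U (k + 2) - U k \<le> 1" and "W k = 1 \<Longrightarrow> W (k + 2) = 0 \<Longrightarrow> U (k + 2) \<le> U k"
proof -
  from assms(1) obtain \<alpha> \<rho> \<sigma> :: real where a: "0 < \<alpha>" "\<alpha> < 1/2" and
    *: "\<And>k. k \<le> n \<Longrightarrow> of_int (U k) \<le> k * \<alpha> + \<rho>" "\<And>k. k \<le> n \<Longrightarrow> k * \<alpha> + \<rho> < of_int (U k) + 1"
    "\<And>k. k \<le> n \<Longrightarrow> of_int (U k) - of_int (W k) \<le> k * \<alpha> + \<sigma>"
    "\<And>k. k \<le> n \<Longrightarrow> k * \<alpha> + \<sigma> < of_int (U k) - of_int (W k) + 1"
    using crossingsE by metis
  have l: "k \<le> n" using assms by auto
  note b = *[OF l] *[OF assms(2)]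
  have e: "(k + 2) * \<alpha> = k * \<alpha> + 2 * \<alpha>" by (simp add: algebra_simps)
  have "real_of_int (U (k + 2) - U k) < of_int 2"
    using b a unfolding e by simp
  then show "U (k + 2) - U k \<le> 1" unfolding of_int_less_iff by auto
  assume "W k = 1" "W (k + 2) = 0"
  then have "real_of_int (U (k + 2)) < real_of_int (U k + 1)"
    using b a unfolding e by simp
  then show "U (k + 2) \<le> U k" unfolding of_int_less_iff by auto
qed

text \<open>If the step from \<open>1\<close> to \<open>1\<close> completed a turn, so would the
  step from \<open>0\<close> to \<open>0\<close>, by the parallelogram. The former needs an arc of
  length \<open>\<rho> - \<sigma> > 1 - \<alpha>\<close>, the latter
  \<open>\<rho> - \<sigma> < \<alpha>\<close>, contrary to \<open>\<alpha> < 1/2\<close>.\<close>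

lemma crossings_00_11:
  assumes "crossings n W U" "s < n" "t < n"
    and "W s = 1" "W (Suc s) = 1" "W t = 0" "W (Suc t) = 0"
  shows "U (Suc s) = U s"
proof -
  from assms(1) obtain \<alpha> \<rho> \<sigma> :: real where a: "0 < \<alpha>" "\<alpha> < 1/2" and
    *: "\<And>k. k \<le> n \<Longrightarrow> of_int (U k) \<le> k * \<alpha> + \<rho>" "\<And>k. k \<le> n \<Longrightarrow> k * \<alpha> + \<rho> < of_int (U k) + 1"
    "\<And>k. k \<le> n \<Longrightarrow> of_int (U k) - of_int (W k) \<le> k * \<alpha> + \<sigma>"
    "\<And>k. k \<le> n \<Longrightarrow> k * \<alpha> + \<sigma> < of_int (U k) - of_int (W k) + 1"
    using crossingsE by metis
  have l: "s \<le> n" "Suc s \<le> n" "t \<le> n" "Suc t \<le> n" using assms by auto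
  have eq: "U (Suc s) - U s = U (Suc t) - U t"
    by (rule crossings_parallelogram[OF assms(1)]) (use assms in auto)
  have e: "Suc s * \<alpha> = s * \<alpha> + \<alpha>" "Suc t * \<alpha> = t * \<alpha> + \<alpha>" by (simp_all add: algebra_simps)
  note b = *[OF l(1)] *[OF l(2)] *[OF l(3)] *[OF l(4)]
  have "\<not> U (Suc s) - U s = 1"
  proof
    assume "U (Suc s) - U s = 1"
    with eq have "U (Suc s) = U s + 1" "U (Suc t) = U t + 1" by auto
    then have "real_of_int (U (Suc s)) = U s + 1" "real_of_int (U (Suc t)) = U t + 1" by auto
    then show False using b a assms(4-7) unfolding e by simp
  qed
  then show ?thesis using crossings_step(1)[OF assms(1,2)] by auto
qed

section \<open>Turns made between two consecutive ones\<close>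

text \<open>The number of turns up to \<open>s + k\<close> is the integer part both of
  \<open>k * \<alpha>\<close>, measured forward from \<open>s\<close>, and of
  \<open>p - (q - k) * \<alpha>\<close>, measured backward from \<open>s + q\<close>. A weighted
  mean of the two is free of \<open>\<alpha>\<close>, so the slope may be replaced by p/q.\<close>

lemma crossings_block:
  assumes "crossings n W U" "s + q \<le> n" "W s = 1" "W (s + q) = 1"
    and "0 < k" "k < q" "W (s + k) = 0"
  shows "int q * (U (s + k) - U s) < int k * (U (s + q) - U s)"
    and "int k * (U (s + q) - U s) < int q * (U (s + k) - U s + 1)"
proof -
  from assms(1) obtain \<alpha> \<rho> \<sigma> :: real where a: "0 < \<alpha>" "\<alpha> < 1/2" and
    *: "\<And>k. k \<le> n \<Longrightarrow> of_int (U k) \<le> k * \<alpha> + \<rho>" "\<And>k. k \<le> n \<Longrightarrow> k * \<alpha> + \<rho> < of_int (U k) + 1"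
    "\<And>k. k \<le> n \<Longrightarrow> of_int (U k) - of_int (W k) \<le> k * \<alpha> + \<sigma>"
    "\<And>k. k \<le> n \<Longrightarrow> k * \<alpha> + \<sigma> < of_int (U k) - of_int (W k) + 1"
    using crossingsE by metis
  have l: "s \<le> n" "s + k \<le> n" using assms by auto
  note b = *[OF l(1)] *[OF l(2)] *[OF assms(2)]
  define p N where "p = U (s + q) - U s" and "N = U (s + k) - U s"
  define m where "m = q - k"
  have qm: "q = k + m" "0 < m" using assms m_def by auto
  have e: "(s + q) * \<alpha> = s * \<alpha> + k * \<alpha> + m * \<alpha>" "(s + k) * \<alpha> = s * \<alpha> + k * \<alpha>"
    by (simp_all add: algebra_simps qm)
  have "N < k * \<alpha>" "N < p - m * \<alpha>" "k * \<alpha> < N + 1" "p - m * \<alpha> < N + 1"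
    using b assms(3,4,7) unfolding e by (simp_all add: p_def N_def)
  \<comment> \<open>The weights \<open>m\<close> and \<open>k\<close> are chosen so that the terms
    with \<open>\<alpha>\<close> cancel and \<open>k * p\<close> remains.\<close>
  then have "real m * N + real k * N < m * (k * \<alpha>) + k * (p - m * \<alpha>)"
    "m * (k * \<alpha>) + k * (p - m * \<alpha>) < real m * (N + 1) + real k * (N + 1)"
    using qm assms(5) by (auto intro!: add_strict_mono mult_strict_left_mono simp del: distrib_left distrib_right)
  then have "real_of_int (int q * N) < of_int (int k * p)"
    "real_of_int (int k * p) < of_int (int q * (N + 1))"
    by (simp_all add: qm algebra_simps)
  then show "int q * (U (s + k) - U s) < int k * (U (s + q) - U s)"
    "int k * (U (s + q) - U s) < int q * (U (s + k) - U s + 1)"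
    unfolding of_int_less_iff p_def N_def .
qed

lemma floor_interval_unique:
  fixes q x N N' :: int
  assumes "q * N < x" "x < q * (N + 1)" "q * N' < x" "x < q * (N' + 1)" "0 < q"
  shows "N = N'"
proof -
  have "q * N < q * (N' + 1)" "q * N' < q * (N + 1)" using assms by linarith+
  then have "N < N' + 1" "N' < N + 1" using assms(5) by (simp_all add: mult_less_cancel_left)
  then show ?thesis by simp
qed

definition consecutive :: "nat \<Rightarrow> (nat \<Rightarrow> int) \<Rightarrow> nat \<Rightarrow> nat \<Rightarrow> bool" where
  "consecutive n W s q \<longleftrightarrow> s + q \<le> n \<and> 0 < q \<and> W s = 1 \<and> W (s + q) = 1 \<and> (\<forall>k. 0 < k \<and> k < q \<longrightarrow> W (s + k) = 0)"

text \<open>A common divisor \<open>g > 1\<close> would make \<open>k0 * p\<close> a multiple of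
  \<open>q\<close> for \<open>k0 = q / g < q\<close>, whereas \<open>crossings_block\<close> puts it
  strictly between two neighbouring multiples.\<close>

lemma crossings_consecutive_coprime:
  assumes "crossings n W U" "consecutive n W s q"
  shows "coprime (U (s + q) - U s) (int q)"
proof -
  define p where "p = U (s + q) - U s"
  define g where "g = gcd p (int q)"
  have q: "0 < q" using assms by (auto simp: consecutive_def)
  then have g: "0 < g" by (simp add: g_def)
  have gq: "g dvd int q" "g dvd p" by (auto simp: g_def)
  then obtain k0 p0 where k0: "int q = g * k0" and p0: "p = g * p0" by (auto simp: dvd_def)
  have k0pos: "0 < k0" using k0 q g by (metis of_nat_0_less_iff zero_less_mult_pos)
  show ?thesis
  proof (rule ccontr)
    assume "\<not> ?thesis"
    then have "g \<noteq> 1" by (simp add: p_def g_def coprime_iff_gcd_eq_1)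
    with g have "1 < g" by simp
    then have "k0 < int q" using k0 k0pos by (simp add: k0)
    then have k: "0 < nat k0" "nat k0 < q" using k0pos by auto
    have c: "s + q \<le> n" "W s = 1" "W (s + q) = 1" "W (s + nat k0) = 0"
      using assms(2) k by (auto simp: consecutive_def)
    from crossings_block[OF assms(1) c(1-3) k c(4)] k0pos
    have "int q * (U (s + nat k0) - U s) < k0 * p" "k0 * p < int q * (U (s + nat k0) - U s + 1)"
      by (simp_all add: p_def)
    moreover have "k0 * p = int q * p0" by (simp add: k0 p0)
    ultimately have "U (s + nat k0) - U s < p0" "p0 < U (s + nat k0) - U s + 1"
      using q by (simp_all add: mult_less_cancel_left)
    then show False by simp
  qed
qed

text \<open>A step from \<open>1\<close> to \<open>0\<close> leaves \<open>U\<close> unchanged, so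
  \<open>crossings_block\<close> at \<open>k = 1\<close> gives 0 < p < q. For
  \<open>3 \<le> q\<close> also the second index is outside the arc, \<open>U\<close> has not grown
  by then, and \<open>k = 2\<close> gives 2p < q. For \<open>q = 2\<close> only p = 1 is
  left.\<close>

lemma crossings_consecutive_bounds:
  assumes "crossings n W U" "consecutive n W s q" "2 \<le> q"
  shows "0 < U (s + q) - U s" and "2 * (U (s + q) - U s) \<le> int q"
    and "3 \<le> q \<Longrightarrow> 2 * (U (s + q) - U s) < int q"
proof -
  define p where "p = U (s + q) - U s"
  have c: "s + q \<le> n" "W s = 1" "W (s + q) = 1" using assms(2) by (auto simp: consecutive_def)
  have z: "W (s + k) = 0" if "0 < k" "k < q" for k using assms(2) that by (auto simp: consecutive_def)
  have W1: "W (Suc s) = 0" using z[of 1] assms(3) by simp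
  have "U (Suc s) - U s = 0"
    using crossings_step[OF assms(1), of s] c assms(3) W1 by auto
  with crossings_block[OF assms(1) c, of 1] z[of 1] assms(3)
  have p: "0 < p" "p < q" by (auto simp: p_def)
  show "0 < U (s + q) - U s" using p by (simp add: p_def)
  have three: "2 * p < int q" if "3 \<le> q"
  proof -
    have "U (s + 2) \<le> U s" using crossings_two_steps(2)[OF assms(1), of s] z[of 2] c that by simp
    then have "int q * (U (s + 2) - U s + 1) \<le> int q * 1" by (intro mult_left_mono) auto
    moreover have "2 * p < int q * (U (s + 2) - U s + 1)"
      using crossings_block(2)[OF assms(1) c, of 2] z[of 2] that by (simp add: p_def)
    ultimately show ?thesis by simp
  qed
  then show "3 \<le> q \<Longrightarrow> 2 * (U (s + q) - U s) < int q" by (simp add: p_def)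
  show "2 * (U (s + q) - U s) \<le> int q"
    using p three assms(3) unfolding p_def by (cases "q = 2") auto
qed

section \<open>Two different gaps have determinant one\<close>

text \<open>\<open>same\<close> says that up to step \<open>q\<close> the slopes p/q and p'/q' make
  the same number of turns; \<open>shift\<close> says that in the longer block \<open>q\<close> more
  steps add exactly \<open>p\<close> turns. The conclusion makes the two slopes Farey
  neighbours.\<close>

lemma determinant_pos:
  fixes p p' q q' :: int
  assumes "0 < q" "q < q'"
    and same: "\<And>k. 0 < k \<Longrightarrow> k < q \<Longrightarrow>
      \<exists>N. q * N < k * p \<and> k * p < q * (N + 1) \<and> q' * N < k * p' \<and> k * p' < q' * (N + 1)"
    and shift: "\<And>k. 0 < k \<Longrightarrow> k < q' - q \<Longrightarrow>
      \<exists>N. q' * N < k * p' \<and> k * p' < q' * (N + 1) \<and>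
          q' * (N + p) < (k + q) * p' \<and> (k + q) * p' < q' * (N + p + 1)"
    and "coprime p' q'" and r: "0 < q * p' - p * q'" "q * p' - p * q' < q'"
  shows "q * p' - p * q' = 1"
proof (rule ccontr)
  assume "\<not> ?thesis"
  with r have r2: "2 \<le> q * p' - p * q'" by linarith
  have q': "2 \<le> q'" using assms by linarith
  \<comment> \<open>The lattice point \<open>(k, y)\<close> closest to the line of slope \<open>p'/q'\<close> from below cannot be placed.\<close>
  obtain a b where ab: "a * p' + b * q' = 1"
    using bezout_int[of p' q'] \<open>coprime p' q'\<close> by (auto simp: coprime_iff_gcd_eq_1)
  define k where "k = a mod q'"
  define y where "y = - b - (a div q') * p'"
  have "k = a - (a div q') * q'" by (simp add: k_def minus_div_mult_eq_mod)
  then have ky: "k * p' - y * q' = 1"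
    using ab by (simp only: y_def) (simp add: algebra_simps)
  have k: "0 \<le> k" "k < q'" using q' by (auto simp: k_def)
  have "k \<noteq> 0"
  proof
    assume "k = 0"
    then have "q' dvd 1" using ky by (metis dvd_triv_right mult_zero_left diff_0 dvd_minus_iff)
    then show False using q' by simp
  qed
  then have k0: "0 < k" using k by simp
  consider "k < q" | "k = q" | "q < k" by linarith
  then show False
  proof cases
    case 1
    from same[OF k0 1] obtain N where N: "q * N < k * p" "k * p < q * (N + 1)"
      "q' * N < k * p'" "k * p' < q' * (N + 1)" by auto
    have "q' * y < k * p'" "k * p' < q' * (y + 1)" using ky q' by (auto simp: algebra_simps)
    then have Ny: "N = y" using floor_interval_unique[of q' N "k * p'" y] N q' by auto
    \<comment> \<open>For the slope p/q the counts at \<open>k\<close> and \<open>q - k\<close> add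
      up to less than \<open>p\<close>. A determinant of at least two forces
      \<open>M \<ge> p - y\<close>, so that they add up to at least \<open>p\<close>.\<close>
    obtain M where M: "q * M < (q - k) * p" "(q - k) * p < q * (M + 1)"
      "q' * M < (q - k) * p'" "(q - k) * p' < q' * (M + 1)" using same[of "q - k"] k0 1 by auto
    have "q' * (p - y) < (q - k) * p'" using ky r2 by (auto simp: algebra_simps)
    then have "q' * (p - y) < q' * (M + 1)" using M by linarith
    then have "p - y < M + 1" using q' by (simp add: mult_less_cancel_left)
    then have "q * (p - y) \<le> q * M" using assms(1) by (intro mult_left_mono) auto
    then show False using M N Ny by (simp add: algebra_simps)
  next
    case 2
    \<comment> \<open>A multiple of \<open>q'\<close> would lie strictly between \<open>0\<close>
      and \<open>q'\<close>.\<close>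
    have "q' * (y - p) = q * p' - p * q' - 1" using ky 2 by (simp add: algebra_simps)
    then have "q' * (y - p) > 0" "q' * (y - p) < q' * 1" using r2 r by auto
    then show False using q' by (simp add: mult_less_cancel_left zero_less_mult_iff)
  next
    case 3
    then obtain N where N: "q' * N < (k - q) * p'" "(k - q) * p' < q' * (N + 1)"
      "q' * (N + p) < k * p'" "k * p' < q' * (N + p + 1)" using shift[of "k - q"] k by auto
    have "q' * y < k * p'" "k * p' < q' * (y + 1)" using ky q' by (auto simp: algebra_simps)
    then have "N + p = y" using floor_interval_unique[of q' "N + p" "k * p'" y] N q' by auto
    \<comment> \<open>With \<open>N = y - p\<close>, the bound \<open>q' * N < (k - q) * p'\<close>
      says that the determinant is less than one.\<close>
    then show False using N ky r2 by (auto simp: algebra_simps)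
  qed
qed

lemma determinant_abs:
  fixes p p' q q' :: int
  assumes "0 < q" "q < q'"
    and same: "\<And>k. 0 < k \<Longrightarrow> k < q \<Longrightarrow>
      \<exists>N. q * N < k * p \<and> k * p < q * (N + 1) \<and> q' * N < k * p' \<and> k * p' < q' * (N + 1)"
    and shift: "\<And>k. 0 < k \<Longrightarrow> k < q' - q \<Longrightarrow>
      \<exists>N. q' * N < k * p' \<and> k * p' < q' * (N + 1) \<and>
          q' * (N + p) < (k + q) * p' \<and> (k + q) * p' < q' * (N + p + 1)"
    and cop: "coprime p' q'" and r: "q * p' - p * q' \<noteq> 0" "\<bar>q * p' - p * q'\<bar> < q'"
  shows "\<bar>q * p' - p * q'\<bar> = 1"
proof (cases "0 < q * p' - p * q'")
  case True
  then show ?thesis using determinant_pos[OF assms(1,2) same shift cop] r by auto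
next
  case False
  \<comment> \<open>The reflection of the circle replaces \<open>p/q\<close> by \<open>1 - p/q\<close> and changes the sign of the determinant.\<close>
  have "q * (q' - p') - (q - p) * q' = 1"
  proof (rule determinant_pos[OF assms(1,2)])
    show "coprime (q' - p') q'"
    proof (rule coprimeI)
      fix c assume "c dvd q' - p'" "c dvd q'"
      then have "c dvd q' - (q' - p')" by (rule dvd_diff[rotated])
      then have "c dvd p'" by simp
      then show "is_unit c" by (rule coprime_common_divisor[OF cop _ \<open>c dvd q'\<close>])
    qed
    show "0 < q * (q' - p') - (q - p) * q'" "q * (q' - p') - (q - p) * q' < q'"
      using False r by (auto simp: algebra_simps)
    fix k :: int
    assume k: "0 < k"
    { assume "k < q"
      from same[OF k this] obtain N where N: "q * N < k * p \<and> k * p < q * (N + 1) \<and> q' * N < k * p' \<and> k * p' < q' * (N + 1)" ..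
      show "\<exists>N. q * N < k * (q - p) \<and> k * (q - p) < q * (N + 1) \<and> q' * N < k * (q' - p') \<and> k * (q' - p') < q' * (N + 1)"
        \<comment> \<open>As \<open>k * p / q\<close> is not an integer, reflection turns its
          integer part \<open>N\<close> into \<open>k - 1 - N\<close>.\<close>
        by (rule exI[of _ "k - 1 - N"]) (use N in \<open>auto simp: algebra_simps\<close>) }
    { assume "k < q' - q"
      from shift[OF k this] obtain N where N: "q' * N < k * p' \<and> k * p' < q' * (N + 1) \<and>
          q' * (N + p) < (k + q) * p' \<and> (k + q) * p' < q' * (N + p + 1)" ..
      show "\<exists>N. q' * N < k * (q' - p') \<and> k * (q' - p') < q' * (N + 1) \<and>
          q' * (N + (q - p)) < (k + q) * (q' - p') \<and> (k + q) * (q' - p') < q' * (N + (q - p) + 1)"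
        by (rule exI[of _ "k - 1 - N"]) (use N in \<open>auto simp: algebra_simps\<close>) }
  qed
  then show ?thesis by (simp add: algebra_simps)
qed

text \<open>Modulo \<open>q\<close>, both \<open>p\<close> and \<open>r\<close> are inverse to
  \<open>q'\<close> up to sign, so \<open>q\<close> divides \<open>p - r\<close> or
  \<open>p + r\<close>. In the range up to q/2 either case forces equality; in the second both
  numbers are q/2.\<close>

lemma residue_determined_up_to_sign:
  fixes p p' r r' q q' :: int
  assumes "\<bar>q * p' - p * q'\<bar> = 1" "\<bar>q * r' - r * q'\<bar> = 1"
    and "0 < p" "2 * p \<le> q" "0 < r" "2 * r \<le> q"
  shows "p = r"
proof -
  have cop: "coprime q q'"
  proof (rule coprimeI)
    fix c assume "c dvd q" "c dvd q'"
    then have "c dvd q * p' - p * q'" by simp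
    then have "c dvd \<bar>q * p' - p * q'\<bar>" by simp
    then show "is_unit c" using assms(1) by simp
  qed
  from assms(1,2) consider "q * p' - p * q' = q * r' - r * q'" | "q * p' - p * q' = - (q * r' - r * q')"
    by linarith
  then show ?thesis
  proof cases
    case 1
    then have "(p - r) * q' = q * (p' - r')" by (simp add: algebra_simps)
    then have "q dvd (p - r) * q'" by simp
    then have "q dvd p - r" using cop coprime_dvd_mult_left_iff by blast
    moreover have "\<bar>p - r\<bar> < q" using assms by linarith
    ultimately show ?thesis using zdvd_not_zless[of "\<bar>p - r\<bar>" q] by (cases "p = r") auto
  next
    case 2
    then have "(p + r) * q' = q * (p' + r')" by (simp add: algebra_simps)
    then have "q dvd (p + r) * q'" by simp
    then have "q dvd p + r" using cop coprime_dvd_mult_left_iff by blast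
    then have "q \<le> p + r" using assms by (intro zdvd_imp_le) auto
    then show ?thesis using assms by linarith
  qed
qed

text \<open>The hypotheses \<open>same\<close> and \<open>shift\<close> of
  \<open>determinant_abs\<close> are parallelograms: the former compares index \<open>j\<close> in
  both blocks, the latter compares the return from \<open>s\<close> to \<open>s + q\<close> with a
  displacement by \<open>q\<close> between two zeros of the longer block. Balance bounds the
  determinant.\<close>

lemma crossings_determinant_less:
  assumes "crossings n W U" "consecutive n W s q" "consecutive n W s' q'" "q < q'"
  shows "\<bar>int q * (U (s' + q') - U s') - (U (s + q) - U s) * int q'\<bar> = 1"
proof -
  define p p' where "p = U (s + q) - U s" and "p' = U (s' + q') - U s'"
  have c: "s + q \<le> n" "0 < q" "W s = 1" "W (s + q) = 1" "\<And>k. 0 < k \<Longrightarrow> k < q \<Longrightarrow> W (s + k) = 0"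
    using assms(2) by (auto simp: consecutive_def)
  have c': "s' + q' \<le> n" "0 < q'" "W s' = 1" "W (s' + q') = 1" "\<And>k. 0 < k \<Longrightarrow> k < q' \<Longrightarrow> W (s' + k) = 0"
    using assms(3) by (auto simp: consecutive_def)
  note b = crossings_block[OF assms(1) c(1,3,4) _ _ c(5), folded p_def]
  note b' = crossings_block[OF assms(1) c'(1,3,4) _ _ c'(5), folded p'_def]
  have "\<bar>int q * p' - p * int q'\<bar> = 1"
  proof (rule determinant_abs)
    show "0 < int q" "int q < int q'" using c assms by auto
    show "coprime p' (int q')"
      using crossings_consecutive_coprime[OF assms(1,3)] by (simp add: p'_def)
    define N where "N = U (s' + q) - U s'"
    have N: "int q' * N < int q * p'" "int q * p' < int q' * (N + 1)"
      using b'[of q] c(2) assms(4) by (auto simp: N_def)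
    have W0: "W (s' + q) = 0" using c' c assms(4) by auto
    have "\<bar>p - N\<bar> \<le> 1" "\<bar>p - (N + 1)\<bar> \<le> 1"
      using crossings_balanced[OF assms(1) c(1), of s'] c' assms(4) W0
      by (auto simp: p_def N_def algebra_simps)
    \<comment> \<open>For \<open>N = p\<close> the determinant lies strictly between
      \<open>0\<close> and \<open>q'\<close>, for \<open>N = p - 1\<close> strictly between
      \<open>- q'\<close> and \<open>0\<close>.\<close>
    then have "N = p \<or> N = p - 1" by linarith
    then show "int q * p' - p * int q' \<noteq> 0" "\<bar>int q * p' - p * int q'\<bar> < int q'"
      using N by (auto simp: algebra_simps)
    fix k :: int assume k: "0 < k"
    then obtain j where j: "k = int j" by (metis pos_int_cases)
    { assume kq: "k < int q"
      have jq: "0 < j" "j < q" "j < q'" using k kq j assms(4) by auto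
      have "U (s' + j) - U (s + j) = U s' - U s"
        by (rule crossings_parallelogram[OF assms(1), symmetric]) (use c c' jq in auto)
      then have "U (s' + j) - U s' = U (s + j) - U s" by simp
      then show "\<exists>N. int q * N < k * p \<and> k * p < int q * (N + 1) \<and> int q' * N < k * p' \<and> k * p' < int q' * (N + 1)"
        using b[OF jq(1,2) jq(1,2)] b'[OF jq(1,3) jq(1,3)]
        by (intro exI[of _ "U (s + j) - U s"]) (simp add: j) }
    { assume kq: "k < int q' - int q"
      have jq: "0 < j" "j + q < q'" "j < q'" using k kq j by auto
      have "U (s + q) - U s = U (s' + (j + q)) - U (s' + j)"
        by (rule crossings_parallelogram[OF assms(1)]) (use c c' jq in auto)
      then have "U (s' + (j + q)) - U s' = U (s' + j) - U s' + p" by (simp add: p_def)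
      then show "\<exists>N. int q' * N < k * p' \<and> k * p' < int q' * (N + 1) \<and>
          int q' * (N + p) < (k + int q) * p' \<and> (k + int q) * p' < int q' * (N + p + 1)"
        using b'[OF _ jq(2) _ jq(2)] b'[OF jq(1,3) jq(1,3)] jq(1)
        by (intro exI[of _ "U (s' + j) - U s'"]) (simp add: j algebra_simps) }
  qed
  then show ?thesis by (simp add: p_def p'_def)
qed

lemma crossings_determinant:
  assumes "crossings n W U" "consecutive n W s q" "consecutive n W s' q'" "q \<noteq> q'"
  shows "\<bar>int q * (U (s' + q') - U s') - (U (s + q) - U s) * int q'\<bar> = 1"
proof (cases "q < q'")
  case True
  then show ?thesis using crossings_determinant_less[OF assms(1-3)] by simp
next
  case False
  then have "\<bar>int q' * (U (s + q) - U s) - (U (s' + q') - U s') * int q\<bar> = 1"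
    using crossings_determinant_less[OF assms(1,3,2)] assms(4) by simp
  then show ?thesis by (simp add: algebra_simps abs_minus_commute)
qed

section \<open>Entering and leaving the arc, and rigidity of the prefix sums\<close>

text \<open>Balance is applied against a return from \<open>1\<close> to \<open>1\<close>, once with
  each word of the pair. Over the entry the second word gains one less than the first, which leaves
  two values, one for each direction of drift.\<close>

lemma crossings_entry:
  assumes "crossings n W U" "s + q \<le> n" "W s = 1" "W (s + q) = 1" "t + q \<le> n" "W t = 0" "W (t + q) = 1"
  shows "U (t + q) - U t \<in> {U (s + q) - U s, U (s + q) - U s + 1}"
  using crossings_balanced[OF assms(1,2,5)] assms(3-) by simp linarith

lemma crossings_exit:
  assumes "crossings n W U" "s + q \<le> n" "W s = 1" "W (s + q) = 1" "t + q \<le> n" "W t = 1" "W (t + q) = 0"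
  shows "U (t + q) - U t \<in> {U (s + q) - U s - 1, U (s + q) - U s}"
  using crossings_balanced[OF assms(1,2,5)] assms(3-) by simp linarith

text \<open>The orbit leaves the arc in the direction in which it entered it.\<close>

lemma crossings_entry_exit:
  assumes "crossings n W U" "s + q \<le> n" "W s = 0" "W (s + q) = 1" "t + q \<le> n" "W t = 1" "W (t + q) = 0"
  shows "U (s + q) - U s = U (t + q) - U t + 1"
  using crossings_balanced[OF assms(1,2,5)] assms(3-) by simp

lemma crossings_diff_parallelogram:
  assumes "crossings n W U" "crossings n W U'" and "s \<le> n" "s' \<le> n" "t \<le> n" "t' \<le> n" "s' + t = s + t'"
    and "W s = 1" "W s' = 1" "W t = 0" "W t' = 0"
  shows "(U s' - U' s') - (U s - U' s) = (U t' - U' t') - (U t - U' t)"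
  using crossings_parallelogram[OF assms(1,3-)] crossings_parallelogram[OF assms(2-)] by simp

text \<open>Agreement of \<open>U\<close> and \<open>U'\<close> spreads to the right in strides of
  \<open>q\<close>. A stride between two zeros is compared with the return from \<open>a\<close> to
  \<open>a + q\<close>; a stride that leaves the arc is left to the hypothesis
  \<open>exits\<close>.\<close>

lemma crossings_tail_rigid:
  assumes U: "crossings n W U" "crossings n W U'"
    and bin: "\<And>t. t \<le> n \<Longrightarrow> W t = 0 \<or> W t = 1"
    and a: "W a = 1" "W (a + q) = 1" "0 < q" "lo \<le> a" "a + q \<le> m" "m \<le> n"
    and int: "\<And>t. lo \<le> t \<Longrightarrow> t \<le> m \<Longrightarrow> U t - U' t = d"
    and zero: "\<And>t. m < t \<Longrightarrow> t \<le> n \<Longrightarrow> W t = 0"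
    and exits: "\<And>t. m < t \<Longrightarrow> t \<le> n \<Longrightarrow> W (t - q) = 1 \<Longrightarrow> U t - U' t = U (t - q) - U' (t - q)"
    and t: "lo \<le> t" "t \<le> n"
  shows "U t - U' t = d"
  using t
proof (induction t rule: less_induct)
  case (less t)
  show ?case
  proof (cases "t \<le> m")
    case False
    then have l: "lo \<le> t - q" "t - q < t" "t - q \<le> n" using less.prems a by auto
    have IH: "U (t - q) - U' (t - q) = d" using less.IH l by auto
    show ?thesis
    proof (cases "W (t - q) = 1")
      case False
      have "(U (a + q) - U' (a + q)) - (U a - U' a) = (U t - U' t) - (U (t - q) - U' (t - q))"
        by (rule crossings_diff_parallelogram[OF U])
           (use \<open>\<not> t \<le> m\<close> False a l less.prems bin zero in auto)
      then show ?thesis using int[of a] int[of "a + q"] a IH by simp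
    qed (use exits IH False less.prems in auto)
  qed (use int less.prems in auto)
qed

lemma crossings_head_rigid:
  assumes U: "crossings n W U" "crossings n W U'"
    and bin: "\<And>t. t \<le> n \<Longrightarrow> W t = 0 \<or> W t = 1"
    and a: "W a = 1" "W (a + q) = 1" "0 < q" "lo \<le> a" "a + q \<le> m" "m \<le> n"
    and int: "\<And>t. lo \<le> t \<Longrightarrow> t \<le> m \<Longrightarrow> U t - U' t = d"
    and zero: "\<And>t. t < lo \<Longrightarrow> W t = 0"
    and entries: "\<And>t. t < lo \<Longrightarrow> W (t + q) = 1 \<Longrightarrow> U t - U' t = U (t + q) - U' (t + q)"
    and t: "t \<le> m"
  shows "U t - U' t = d"
  using t
\<comment> \<open>The strides now go to the right from \<open>t\<close> until they reach
  \<open>lo\<close>, so the distance to \<open>lo\<close> decreases.\<close>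
proof (induction "lo - t" arbitrary: t rule: less_induct)
  case less
  show ?case
  proof (cases "lo \<le> t")
    case False
    then have l: "t + q \<le> m" "lo - (t + q) < lo - t" using less.prems a by auto
    have IH: "U (t + q) - U' (t + q) = d" using less.hyps l by auto
    show ?thesis
    proof (cases "W (t + q) = 1")
      case False
      have "(U (a + q) - U' (a + q)) - (U a - U' a) = (U (t + q) - U' (t + q)) - (U t - U' t)"
        by (rule crossings_diff_parallelogram[OF U])
           (use \<open>\<not> lo \<le> t\<close> False a l less.prems bin[of "t + q"] zero in auto)
      then show ?thesis using int[of a] int[of "a + q"] a IH by simp
    qed (use entries IH False less.prems in auto)
  qed (use int less.prems in auto)
qed

text \<open>By \<open>crossings_block\<close>, the turns up to \<open>k\<close> are the integer part
  of k p / q, hence determined by the turns of the whole block.\<close>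

lemma crossings_block_rigid:
  assumes U: "crossings n W U" "crossings n W U'" and c: "consecutive n W s q"
    and p: "U (s + q) - U s = U' (s + q) - U' s" and k: "k \<le> q"
  shows "U (s + k) - U' (s + k) = U s - U' s"
proof (cases "k = 0 \<or> k = q")
  case False
  then have k: "0 < k" "k < q" using k by auto
  have c: "s + q \<le> n" "W s = 1" "W (s + q) = 1" "W (s + k) = 0" using c k by (auto simp: consecutive_def)
  have "U (s + k) - U s = U' (s + k) - U' s"
    using crossings_block[OF U(1) c(1-3) k c(4)] crossings_block[OF U(2) c(1-3) k c(4)] k
    unfolding p by (intro floor_interval_unique[of "int q" _ "int k * (U' (s + q) - U' s)"]) auto
  then show ?thesis by simp
qed (use p in auto)

lemma consecutive_around:
  assumes "W lo = 1" "W m = 1" "lo < t" "t \<le> m" "m \<le> n"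
    and bin: "\<And>t. t \<le> n \<Longrightarrow> W t = 0 \<or> W t = (1::int)"
  obtains s q where "consecutive n W s q" "lo \<le> s" "s < t" "t \<le> s + q" "s + q \<le> m"
proof -
  let ?A = "{s. s < t \<and> W s = 1}"
  let ?P = "\<lambda>e. t \<le> e \<and> W e = 1"
  define s e where "s = Max ?A" and "e = (LEAST e. ?P e)"
  have "finite ?A" "lo \<in> ?A" using assms by auto
  then have s: "s \<in> ?A" "lo \<le> s" "\<And>x. x \<in> ?A \<Longrightarrow> x \<le> s"
    unfolding s_def using Max_in[of ?A] Max_ge[of ?A] by (blast+)
  have e: "?P e" "e \<le> m" "\<And>x. ?P x \<Longrightarrow> e \<le> x"
    unfolding e_def using LeastI[of ?P m] Least_le[of ?P] assms by auto
  have z: "W (s + k) = 0" if "0 < k" "k < e - s" for k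
  proof -
    have "W (s + k) \<noteq> 1" using s(3)[of "s + k"] e(3)[of "s + k"] that by force
    moreover have "s + k \<le> n" using that e(2) assms(5) by linarith
    ultimately show ?thesis using bin[of "s + k"] by auto
  qed
  have "e \<le> n" using e(2) assms(5) by linarith
  show ?thesis
    by (rule that[of s "e - s"]) (use \<open>e \<le> n\<close> s(1,2) e(1,2) z in \<open>auto simp: consecutive_def\<close>)
qed

text \<open>Blocks between consecutive ones cover the stretch from \<open>lo\<close> to
  \<open>m\<close>, and each passes the difference \<open>U - U'\<close> from its left end to all
  its indices.\<close>

lemma crossings_interior_rigid:
  assumes U: "crossings n W U" "crossings n W U'"
    and bin: "\<And>t. t \<le> n \<Longrightarrow> W t = 0 \<or> W t = 1"
    and ones: "W lo = 1" "W m = 1" "m \<le> n"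
    and p: "\<And>s q. consecutive n W s q \<Longrightarrow> U (s + q) - U s = U' (s + q) - U' s"
    and t: "lo \<le> t" "t \<le> m"
  shows "U t - U' t = U lo - U' lo"
  using t
proof (induction t rule: less_induct)
  case (less t)
  show ?case
  proof (cases "t = lo")
    case False
    then obtain s q where s: "consecutive n W s q" "lo \<le> s" "s < t" "t \<le> s + q"
      using consecutive_around[of W lo m t n] ones bin less.prems by (metis le_neq_implies_less)
    then have "U s - U' s = U lo - U' lo" using less.IH[of s] less.prems by simp
    then show ?thesis using crossings_block_rigid[OF U s(1) p[OF s(1)], of "t - s"] s by auto
  qed simp
qed

lemma first_last_one:
  fixes W :: "nat \<Rightarrow> int"
  assumes "W a = 1" "a \<le> n"
  obtains lo m where "W lo = 1" "W m = 1" "m \<le> n" "\<And>t. t \<le> n \<Longrightarrow> W t = 1 \<Longrightarrow> lo \<le> t \<and> t \<le> m"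
proof -
  let ?A = "{t. t \<le> n \<and> W t = 1}"
  have "finite ?A" by (rule finite_subset[of _ "{..n}"]) auto
  moreover have "?A \<noteq> {}" using assms by auto
  ultimately have A: "finite ?A" "?A \<noteq> {}" .
  show ?thesis
    by (rule that[of "Min ?A" "Max ?A"]) (use Min_in[OF A] Max_in[OF A] A in auto)
qed

section \<open>Words with a unique generating pair\<close>

text \<open>Every block has a partner of different length, so the determinant fixes its turns. The
  longer block contains a displacement by \<open>q\<close> out of the arc, starting at
  \<open>s'\<close>, and one into the arc, ending at \<open>s' + q'\<close>. They fix the direction
  of drift, and with it the exits after the last \<open>1\<close> and the entries before the
  first.\<close>

lemma crossings_rigid_unequal_gaps_less:
  assumes U: "crossings n W U" "crossings n W U'"
    and bin: "\<And>t. t \<le> n \<Longrightarrow> W t = 0 \<or> W t = 1"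
    and no11: "\<And>t. t < n \<Longrightarrow> \<not> (W t = 1 \<and> W (Suc t) = 1)"
    and c: "consecutive n W s q" "consecutive n W s' q'" "q < q'"
    and t: "t \<le> n"
  shows "U t - U' t = U 0 - U' 0"
proof -
  have s: "s + q \<le> n" "0 < q" "W s = 1" "W (s + q) = 1" using c(1) by (auto simp: consecutive_def)
  have s': "s' + q' \<le> n" "W s' = 1" "W (s' + q') = 1" "W (s' + q) = 0" "W (s' + q' - q) = 0"
    using c(2,3) s(2) by (auto simp: consecutive_def)
      (metis add_diff_cancel_left' add_diff_assoc diff_less less_imp_le_nat less_trans zero_less_diff)
  obtain lo m where lm: "W lo = 1" "W m = 1" "m \<le> n"
    and between: "\<And>t. t \<le> n \<Longrightarrow> W t = 1 \<Longrightarrow> lo \<le> t \<and> t \<le> m"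
    using first_last_one[of W s n] s by auto
  have ge2: "2 \<le> r" if "consecutive n W a r" for a r
    using that no11[of a] by (cases "r = 1") (auto simp: consecutive_def)
  have eq: "U (a + r) - U a = U' (a + r) - U' a" if a: "consecutive n W a r" for a r
  proof -
    obtain b r' where b: "consecutive n W b r'" "r \<noteq> r'" using c by (metis less_irrefl)
    show ?thesis
      by (rule residue_determined_up_to_sign[OF crossings_determinant[OF U(1) a b] crossings_determinant[OF U(2) a b]])
         (use crossings_consecutive_bounds[OF U(1) a ge2[OF a]] crossings_consecutive_bounds[OF U(2) a ge2[OF a]] in auto)
  qed
  have int: "U t - U' t = U lo - U' lo" if "lo \<le> t" "t \<le> m" for t
    by (rule crossings_interior_rigid[OF U bin lm eq that])
  have a: "lo \<le> s" "s + q \<le> m" using between s by auto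
  have b: "lo \<le> s'" "s' + q' \<le> m" using between s' by auto
  have tail: "U t - U' t = U lo - U' lo" if t: "lo \<le> t" "t \<le> n" for t
  proof (rule crossings_tail_rigid[OF U bin s(3,4,2) a lm(3) int _ _ t])
    fix t assume t: "m < t" "t \<le> n"
    show z: "W t = 0" using between[OF t(2)] bin[OF t(2)] t by auto
    assume "W (t - q) = 1"
    then have "(U (t - q) - U' (t - q)) - (U s' - U' s') = (U t - U' t) - (U (s' + q) - U' (s' + q))"
      using z s' t c a b by (intro crossings_diff_parallelogram[OF U]) auto
    then show "U t - U' t = U (t - q) - U' (t - q)" using int[of s'] int[of "s' + q"] b c by auto
  qed
  have head: "U t - U' t = U lo - U' lo" if t: "t \<le> m" for t
  proof (rule crossings_head_rigid[OF U bin s(3,4,2) a lm(3) int _ _ t])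
    fix t assume t: "t < lo"
    show z: "W t = 0" using between[of t] bin[of t] t lm s a by auto
    assume "W (t + q) = 1"
    then have "(U (s' + q') - U' (s' + q')) - (U (t + q) - U' (t + q)) = (U (s' + q' - q) - U' (s' + q' - q)) - (U t - U' t)"
      using z s' t c a b by (intro crossings_diff_parallelogram[OF U]) auto
    then show "U t - U' t = U (t + q) - U' (t + q)" using int[of "s' + q'"] int[of "s' + q' - q"] b c by auto
  qed
  show ?thesis using head[of 0] head[of t] tail[of t] t a by (cases "t \<le> m") auto
qed

lemma crossings_rigid_unequal_gaps:
  assumes U: "crossings n W U" "crossings n W U'"
    and bin: "\<And>t. t \<le> n \<Longrightarrow> W t = 0 \<or> W t = 1"
    and no11: "\<And>t. t < n \<Longrightarrow> \<not> (W t = 1 \<and> W (Suc t) = 1)"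
    and c: "consecutive n W s q" "consecutive n W s' q'" "q \<noteq> q'"
    and t: "t \<le> n"
  shows "U t - U' t = U 0 - U' 0"
  using crossings_rigid_unequal_gaps_less[OF U bin no11 c(1,2) _ t]
    crossings_rigid_unequal_gaps_less[OF U bin no11 c(2,1) _ t] c(3) by linarith

text \<open>Every step of \<open>U\<close> is forced: it is zero between equal letters, by
  \<open>crossings_00_11\<close> and the parallelogram, and between different letters it is the only
  value for which both words have letters \<open>0\<close> or \<open>1\<close>.\<close>

lemma crossings_rigid_00_11:
  assumes U: "crossings n W U" "crossings n W U'"
    and bin: "\<And>t. t \<le> n \<Longrightarrow> W t = 0 \<or> W t = 1"
    and s: "s < n" "W s = 1" "W (Suc s) = 1" and z: "z < n" "W z = 0" "W (Suc z) = 0"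
    and t: "t \<le> n"
  shows "U t - U' t = U 0 - U' 0"
  using t
proof (induction t)
  case (Suc t)
  have step: "U (Suc t) = U t" if "crossings n W U" "W t = W (Suc t)" for U
  proof (cases "W t = 1")
    case True
    then show ?thesis using crossings_00_11[OF that(1) _ z(1) _ _ z(2,3), of t] that Suc.prems by auto
  next
    case False
    then have "W t = 0" "W (Suc t) = 0" using bin[of t] that Suc.prems by auto
    then have "U (Suc s) - U s = U (Suc t) - U t"
      using s Suc.prems by (intro crossings_parallelogram[OF that(1)]) auto
    then show ?thesis using crossings_00_11[OF that(1) s(1) z(1) s(2,3) z(2,3)] by simp
  qed
  have "U (Suc t) - U t = U' (Suc t) - U' t"
  proof (cases "W t = W (Suc t)")
    case False
    then show ?thesis
      using crossings_step[OF U(1), of t] crossings_step[OF U(2), of t] bin[of t] bin[of "Suc t"] Suc.prems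
      by auto
  qed (simp add: step[OF U(1)] step[OF U(2)])
  then show ?case using Suc by simp
qed simp

section \<open>Equal gaps: ones in arithmetic progression\<close>

lemma equal_gaps_progression:
  assumes bin: "\<And>t. t \<le> n \<Longrightarrow> W t = 0 \<or> W t = (1::int)"
    and c: "consecutive n W s0 q" and eq: "\<And>s r. consecutive n W s r \<Longrightarrow> r = q"
  obtains i k where "1 \<le> k" "i + k * q \<le> n" "\<forall>t\<le>n. W t = (if \<exists>c\<le>k. t = i + c * q then 1 else 0)"
proof -
  have s0: "s0 + q \<le> n" "W s0 = 1" "W (s0 + q) = 1" "0 < q" using c by (auto simp: consecutive_def)
  obtain i m where lm: "W i = 1" "W m = 1" "m \<le> n"
    and between: "\<And>t. t \<le> n \<Longrightarrow> W t = 1 \<Longrightarrow> i \<le> t \<and> t \<le> m"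
    using first_last_one[of W s0 n] s0 by auto
  have prev: "i + q \<le> t \<and> W (t - q) = 1" if t: "W t = 1" "i < t" "t \<le> n" for t
  proof -
    \<comment> \<open>With \<open>t\<close> itself as right bound, the block found ends exactly at
      \<open>t\<close>.\<close>
    obtain s r where s: "consecutive n W s r" "i \<le> s" "s < t" "t \<le> s + r" "s + r \<le> t"
      using consecutive_around[OF lm(1) t(1,2) order_refl t(3) bin] by metis
    then have "t = s + q" using eq by force
    then show ?thesis using s by (auto simp: consecutive_def)
  qed
  have A: "\<exists>c. t = i + c * q" if "W t = 1" "t \<le> n" for t
    using that
  proof (induction t rule: less_induct)
    case (less t)
    show ?case
    proof (cases "t = i")
      case False
      then have "i < t" using between less.prems by (metis le_neq_implies_less)
      with prev less.prems have p: "i + q \<le> t" "W (t - q) = 1" by auto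
      then obtain c where "t - q = i + c * q" using less s0 by (metis diff_less diff_le_self add_gr_0 le_trans less_le_trans trans_less_add2)
      then have "t = i + Suc c * q" using p by simp
      then show ?thesis by blast
    qed (auto intro: exI[of _ 0])
  qed
  obtain k where k: "m = i + k * q" using A lm by blast
  have B: "W (i + c * q) = 1" if "c \<le> k" for c
    using that
  proof (induction c rule: inc_induct)
    case (step c)
    then have "Suc c * q \<le> k * q" by (intro mult_le_mono1) auto
    then have "i + Suc c * q \<le> n" using lm k by linarith
    then show ?case using prev[of "i + Suc c * q"] step s0 by simp
  qed (use lm k in simp)
  show ?thesis
  proof (rule that)
    show "1 \<le> k" using between[of s0] between[of "s0 + q"] s0 k by (cases k) auto
    show "i + k * q \<le> n" using k lm by simp
    show "\<forall>t\<le>n. W t = (if \<exists>c\<le>k. t = i + c * q then 1 else 0)"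
    proof (intro allI impI)
      fix t assume t: "t \<le> n"
      show "W t = (if \<exists>c\<le>k. t = i + c * q then 1 else 0)"
      proof (cases "W t = 1")
        case True
        then obtain c where c: "t = i + c * q" using A t by blast
        then have "c * q \<le> k * q" using between[OF t True] k by simp
        then show ?thesis using True c s0 by auto
      next
        case False
        then show ?thesis using bin[OF t] B by auto
      qed
    qed
  qed
qed

lemma progression_consecutive:
  fixes W :: "nat \<Rightarrow> int"
  assumes W: "\<And>t. t \<le> n \<Longrightarrow> W t = (if \<exists>c\<le>k. t = i + c * q then 1 else 0)"
    and q: "0 < q" and n: "i + k * q \<le> n" and c: "c < k"
  shows "consecutive n W (i + c * q) q"
proof -
  have "Suc c * q \<le> k * q" using c by (intro mult_le_mono1) auto
  then have l: "i + c * q + q \<le> n" using n by simp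
  have "W (i + c * q + q) = 1" using W[OF l] c by (auto intro!: exI[of _ "Suc c"])
  moreover have "W (i + c * q + j) = 0" if j: "0 < j" "j < q" for j
  proof -
    have "c * q + j \<noteq> d * q" for d
      using j by (metis mod_less mod_mult_self2_is_0 mod_mult_self3 less_irrefl)
    then show ?thesis using W[of "i + c * q + j"] l j by (simp add: add.assoc)
  qed
  ultimately show ?thesis using l c q W[of "i + c * q"] by (auto simp: consecutive_def)
qed

lemma progression_consecutiveD:
  fixes W :: "nat \<Rightarrow> int"
  assumes W: "\<And>t. t \<le> n \<Longrightarrow> W t = (if \<exists>c\<le>k. t = i + c * q then 1 else 0)"
    and q: "0 < q" and n: "i + k * q \<le> n" and s: "consecutive n W s r"
  shows "r = q \<and> (\<exists>c<k. s = i + c * q)"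
proof -
  have s': "s + r \<le> n" "0 < r" "W s = 1" "W (s + r) = 1" "\<And>j. 0 < j \<Longrightarrow> j < r \<Longrightarrow> W (s + j) = 0"
    using s by (auto simp: consecutive_def)
  obtain c d where cd: "s = i + c * q" "s + r = i + d * q" "d \<le> k"
    using W[of s] W[of "s + r"] s' by (auto split: if_splits)
  then have "c * q < d * q" using s'(2) by linarith
  then have "c < d" by simp
  then have "Suc c * q \<le> d * q" by (intro mult_le_mono1) auto
  then have "q \<le> r" using cd by simp
  moreover have "\<not> q < r"
    using s'(5)[of q] q progression_consecutive[OF W q n, of c] \<open>c < d\<close> cd by (auto simp: consecutive_def)
  moreover have "c < k" using cd \<open>c < d\<close> by simp
  ultimately show ?thesis using cd by auto
qed

text \<open>With a single gap length no block shows the direction of drift, so the increments over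
  the first entry and the last exit become data next to the number of turns.\<close>

lemma crossings_rigid_equal_gaps:
  assumes U: "crossings n W U" "crossings n W U'"
    and W: "\<And>t. t \<le> n \<Longrightarrow> W t = (if \<exists>c\<le>k. t = i + c * q then 1 else 0)"
    and k: "1 \<le> k" and q: "2 \<le> q" and n: "i + k * q \<le> n"
    and p: "U (i + q) - U i = U' (i + q) - U' i"
    and entry: "q \<le> i \<Longrightarrow> U i - U (i - q) = U' i - U' (i - q)"
    and exit: "i + k * q + q \<le> n \<Longrightarrow> U (i + k * q + q) - U (i + k * q) = U' (i + k * q + q) - U' (i + k * q)"
    and t: "t \<le> n"
  shows "U t - U' t = U 0 - U' 0"
proof -
  have q0: "0 < q" using q by simp
  have bin: "W t = 0 \<or> W t = 1" if "t \<le> n" for t using W[OF that] by simp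
  have kq: "q \<le> k * q" using k by simp
  have c0: "consecutive n W i q" using progression_consecutive[OF W q0 n, of 0] k by simp
  then have one0: "W i = 1" "W (i + q) = 1" "W (i + 1) = 0" using q by (auto simp: consecutive_def)
  have last: "W (i + k * q) = 1" using W[OF n] by auto
  have i1: "i + 1 \<le> n" using n kq q by linarith
  have eq: "U (s + r) - U s = U' (s + r) - U' s" if s: "consecutive n W s r" for s r
  proof -
    have "r = q" using progression_consecutiveD[OF W q0 n s] by simp
    then have s': "s + q \<le> n" "W s = 1" "W (s + q) = 1" "W (s + 1) = 0"
      using s q by (auto simp: consecutive_def)
    have l: "s \<le> n" "s + 1 \<le> n" "i \<le> n" "i + q \<le> n" using s'(1) n kq q by linarith+
    \<comment> \<open>The letters after \<open>s\<close> and \<open>i\<close> are zeros because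
      \<open>2 \<le> q\<close>; comparing both ends of the two blocks with them carries the
      agreement from the first block to every other.\<close>
    have "(U s - U' s) - (U i - U' i) = (U (s + 1) - U' (s + 1)) - (U (i + 1) - U' (i + 1))"
      by (rule crossings_diff_parallelogram[OF U]; (fact | simp))
    moreover have "(U (s + q) - U' (s + q)) - (U (i + q) - U' (i + q)) = (U (s + 1) - U' (s + 1)) - (U (i + 1) - U' (i + 1))"
      by (rule crossings_diff_parallelogram[OF U]; (fact | simp))
    ultimately show ?thesis using p \<open>r = q\<close> by simp
  qed
  have int: "U t - U' t = U i - U' i" if "i \<le> t" "t \<le> i + k * q" for t
    by (rule crossings_interior_rigid[OF U bin one0(1) last n eq that])
  have a: "i + q \<le> i + k * q" using kq by simp
  have range: "i \<le> t \<and> t \<le> i + k * q" if "t \<le> n" "W t = 1" for t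
    using W[OF that(1)] that by (auto split: if_splits intro: mult_le_mono1)
  have tail: "U t - U' t = U i - U' i" if t: "i \<le> t" "t \<le> n" for t
  proof (rule crossings_tail_rigid[OF U bin one0(1,2) q0 order_refl a n int _ _ t])
    fix t assume t: "i + k * q < t" "t \<le> n"
    show "W t = 0" using range[OF t(2)] bin[OF t(2)] t by auto
    assume w: "W (t - q) = 1"
    then obtain c where c: "c \<le> k" "t - q = i + c * q" using W[of "t - q"] t by (auto split: if_splits)
    have "c = k"
    proof (rule ccontr)
      assume "c \<noteq> k"
      then have "Suc c * q \<le> k * q" using c by (intro mult_le_mono1) auto
      then show False using c t by simp
    qed
    moreover have "q \<le> t" using t kq by linarith
    ultimately have "t = i + k * q + q" using c by simp
    then show "U t - U' t = U (t - q) - U' (t - q)" using exit t by simp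
  qed
  have head: "U t - U' t = U i - U' i" if t: "t \<le> i + k * q" for t
  proof (rule crossings_head_rigid[OF U bin one0(1,2) q0 order_refl a n int _ _ t])
    fix t assume t: "t < i"
    show "W t = 0" using range[of t] bin[of t] t n by auto
    assume w: "W (t + q) = 1"
    have "t + q \<le> n" using t n kq by linarith
    then obtain c where c: "c \<le> k" "t + q = i + c * q" using W[of "t + q"] w by (auto split: if_splits)
    have "c = 0" using c t by (cases c) auto
    then have "t + q = i" using c by simp
    then have "t = i - q" "q \<le> i" by simp_all
    then show "U t - U' t = U (t + q) - U' (t + q)" using entry by simp
  qed
  show ?thesis using head[of 0] head[of t] tail[of t] t by (cases "t \<le> i + k * q") auto
qed

section \<open>Construction of pairs with given turns and drift\<close>

text \<open>Changing an integer numerator by less than one affects the floor only if the quotient is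
  an integer and is pushed down.\<close>

lemma floor_div_perturbed:
  fixes N q :: int and x :: real
  assumes "0 < q" "\<bar>x\<bar> < 1"
  shows "\<lfloor>(N + x) / q\<rfloor> = N div q - (if q dvd N \<and> x < 0 then 1 else 0)"
proof -
  define g where "g = N mod q"
  have g: "0 \<le> g" "g + 1 \<le> q" "q dvd N \<longleftrightarrow> g = 0" using assms(1) by (auto simp: g_def dvd_eq_mod_eq_0 zless_imp_add1_zle)
  then have gr: "0 \<le> real_of_int g" "real_of_int g + 1 \<le> q" "0 < real_of_int q" using assms(1) by linarith+
  have "N = q * (N div q) + g" by (simp add: g_def)
  then have N: "real_of_int N = q * (N div q) + g" by (metis of_int_add of_int_mult)
  have eq: "(N + x) / q = of_int (N div q) + (g + x) / q" using gr unfolding N by (simp add: field_simps)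
  show ?thesis
  proof (cases "g = 0 \<and> x < 0")
    case True
    then have "\<lfloor>(N + x) / q\<rfloor> = N div q - 1"
      unfolding eq using gr assms(2) by (intro floor_unique) (auto simp: field_simps)
    then show ?thesis using True g by simp
  next
    case False
    then have "0 \<le> g + x" "g + x < q" using g(1) gr assms(2) by (cases "g = 0"; force)+
    then have "\<lfloor>(N + x) / q\<rfloor> = N div q"
      unfolding eq using gr by (intro floor_unique) (auto simp: field_simps)
    then show ?thesis using False g by auto
  qed
qed

text \<open>The flag \<open>b\<close> is the direction of drift: if it holds, an entry makes
  \<open>p + 1\<close> turns and an exit \<open>p\<close>, otherwise \<open>p\<close> and
  \<open>p - 1\<close>.\<close>

lemma crossings_exists:
  fixes W :: "nat \<Rightarrow> int" and p :: int
  assumes W: "\<And>t. t \<le> n \<Longrightarrow> W t = (if \<exists>c\<le>k. t = i + c * q then 1 else 0)"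
    and k: "1 \<le> k" and n: "i + k * q \<le> n"
    and p: "0 < p" "2 * p < int q" "coprime p (int q)"
  shows "\<exists>U. crossings n W U \<and> U (i + q) - U i = p \<and>
    (q \<le> i \<longrightarrow> U i - U (i - q) = p + (if b then 1 else 0)) \<and>
    (i + k * q + q \<le> n \<longrightarrow> U (i + k * q + q) - U (i + k * q) = p - (if b then 0 else 1))"
proof -
  \<comment> \<open>The slope is \<open>p/q\<close> shifted by \<open>\<eta>/q\<close> to the right or left according to \<open>b\<close>; the arc reaches \<open>\<eta>/2\<close>
    beyond the \<open>k + 1\<close> orbit points, spaced by \<open>\<eta>\<close>, that have to lie in it.\<close>
  define \<eta> :: real where "\<eta> = 1 / (4 * (real n + 1))"
  define z where "z t = int t - int i" for t
  \<comment> \<open>\<open>A\<close> and \<open>B\<close> perturb the numerators of the two floors.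
    At \<open>c * q\<close> the summand \<open>q / 2\<close> keeps them away from zero, and
    \<open>A \<ge> 0 > B\<close> holds exactly for \<open>0 \<le> c \<le> k\<close>, in either
    direction of drift.\<close>
  define A :: "int \<Rightarrow> real" where "A x = (if b then x + q / 2 else k * q + q / 2 - x)" for x
  define B :: "int \<Rightarrow> real" where "B x = A x - (k * q + q)" for x
  define \<alpha> :: real where "\<alpha> = (p + (if b then \<eta> else - \<eta>)) / q"
  define \<rho> :: real where "\<rho> = \<eta> * A 0 / q - i * \<alpha>"
  define \<sigma> :: real where "\<sigma> = \<eta> * B 0 / q - i * \<alpha>"
  define U where "U t = \<lfloor>real t * \<alpha> + \<rho>\<rfloor>" for t
  have q: "0 < q" "0 < int q" "0 < real q" using p by auto
  have kq: "q \<le> k * q" using k by simp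
  then have "q \<le> n" using n by linarith
  have \<eta>: "0 < \<eta>" "\<eta> * (real n + 1) = 1/4" by (auto simp: \<eta>_def)
  have "\<eta> * 1 \<le> \<eta> * (real n + 1)" using \<eta>(1) by (intro mult_left_mono) auto
  then have \<eta>4: "\<eta> \<le> 1/4" using \<eta>(2) by simp
  \<comment> \<open>As \<open>q\<close>, \<open>k * q\<close> and the absolute value of
    \<open>z t\<close> are at most \<open>n\<close>, both \<open>A\<close> and \<open>B\<close> stay
    below \<open>4 * (n + 1)\<close> in absolute value, and \<open>\<eta>\<close> is the inverse of
    this bound.\<close>
  have A_small: "\<bar>\<eta> * A (z t)\<bar> < 1" "\<bar>\<eta> * B (z t)\<bar> < 1" if t: "t \<le> n" for t
  proof -
    have r: "real k * q \<le> n" "real q \<le> n" "real_of_int (z t) \<le> n" "- real_of_int (z t) \<le> n"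
      using n t \<open>q \<le> n\<close> by (auto simp: z_def simp flip: of_nat_mult)
    have r0: "0 \<le> real k * q" "0 \<le> real q" by simp_all
    have "\<bar>A (z t)\<bar> < 4 * real n + 4"
    proof (cases b)
      case True
      then have "A (z t) = z t + real q / 2" by (simp add: A_def)
      then show ?thesis using r r0 by linarith
    next
      case False
      then have "A (z t) = real k * q + real q / 2 - z t" by (simp add: A_def)
      then show ?thesis using r r0 by linarith
    qed
    moreover have "\<bar>B (z t)\<bar> < 4 * real n + 4"
    proof (cases b)
      case True
      then have "B (z t) = z t - real q / 2 - real k * q" by (simp add: A_def B_def)
      then show ?thesis using r r0 by linarith
    next
      case False
      then have "B (z t) = - real q / 2 - z t" by (simp add: A_def B_def)
      then show ?thesis using r r0 by linarith
    qed
    ultimately have "\<eta> * \<bar>A (z t)\<bar> < \<eta> * (4 * real n + 4)" "\<eta> * \<bar>B (z t)\<bar> < \<eta> * (4 * real n + 4)"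
      using \<eta>(1) by (intro mult_strict_left_mono; simp)+
    then show "\<bar>\<eta> * A (z t)\<bar> < 1" "\<bar>\<eta> * B (z t)\<bar> < 1"
      using \<eta>(1) \<eta>(2) by (simp_all add: abs_mult algebra_simps)
  qed
  have dvd: "int q dvd x * p \<longleftrightarrow> int q dvd x" for x
    using p(3) by (simp add: coprime_dvd_mult_left_iff coprime_commute)
  have form: "real t * \<alpha> + \<rho> = (of_int (z t * p) + \<eta> * A (z t)) / of_int (int q)"
    "real t * \<alpha> + \<sigma> = (of_int (z t * p) + \<eta> * B (z t)) / of_int (int q)" for t
    using q by (auto simp: \<alpha>_def \<rho>_def \<sigma>_def A_def B_def z_def field_simps)
  have fl: "\<lfloor>real t * \<alpha> + \<rho>\<rfloor> = (z t * p) div int q - (if int q dvd z t \<and> A (z t) < 0 then 1 else 0)"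
     "\<lfloor>real t * \<alpha> + \<sigma>\<rfloor> = (z t * p) div int q - (if int q dvd z t \<and> B (z t) < 0 then 1 else 0)"
    if t: "t \<le> n" for t
    unfolding form floor_div_perturbed[OF q(2) A_small(1)[OF t]] floor_div_perturbed[OF q(2) A_small(2)[OF t]] dvd
    using \<eta>(1) by (simp_all add: mult_less_0_iff)
  have W_eq: "W t = (if int q dvd z t \<and> B (z t) < 0 then 1 else 0) - (if int q dvd z t \<and> A (z t) < 0 then 1 else 0)"
    if t: "t \<le> n" for t
  proof (cases "int q dvd z t")
    case True
    then obtain c where c: "z t = int q * c" by (auto simp: dvd_def)
    have A: "A (z t) = q * (if b then c + 1/2 else k + 1/2 - c)"
      "B (z t) = q * (if b then c - k - 1/2 else - c - 1/2)"
      by (auto simp: A_def B_def c algebra_simps)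
    have A0: "A (z t) < 0 \<longleftrightarrow> (if b then c < 0 else int k < c)"
    proof -
      have "real_of_int c + 1/2 < 0 \<longleftrightarrow> c < 0" by linarith
      moreover have "real k + 1/2 - real_of_int c < 0 \<longleftrightarrow> int k < c" by linarith
      ultimately show ?thesis unfolding A using q by (auto simp: mult_less_0_iff)
    qed
    have B0: "B (z t) < 0 \<longleftrightarrow> (if b then c \<le> int k else 0 \<le> c)"
    proof -
      have "real_of_int c - k - 1/2 < 0 \<longleftrightarrow> c \<le> int k" by linarith
      moreover have "- real_of_int c - 1/2 < 0 \<longleftrightarrow> 0 \<le> c" by linarith
      ultimately show ?thesis unfolding A using q by (auto simp: mult_less_0_iff)
    qed
    have "(\<exists>d\<le>k. t = i + d * q) \<longleftrightarrow> 0 \<le> c \<and> c \<le> int k"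
    proof
      assume "\<exists>d\<le>k. t = i + d * q"
      then obtain d where d: "d \<le> k" "t = i + d * q" by blast
      have "int q * c = int t - int i" using c by (simp add: z_def)
      also have "\<dots> = int q * int d" by (simp add: d(2))
      finally have "int q * c = int q * int d" .
      then show "0 \<le> c \<and> c \<le> int k" using q d by simp
    next
      assume a: "0 \<le> c \<and> c \<le> int k"
      then have "int t = int (i + nat c * q)" using c by (simp add: z_def algebra_simps)
      then have "t = i + nat c * q" by (simp only: of_nat_eq_iff)
      then show "\<exists>d\<le>k. t = i + d * q" using a by (intro exI[of _ "nat c"]) auto
    qed
    then show ?thesis using W[OF t] A0 B0 True by auto
  next
    case False
    have "t \<noteq> i + d * q" for d
    proof
      assume "t = i + d * q"
      then have "z t = int q * int d" by (simp add: z_def)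
      then show False using False by simp
    qed
    then show ?thesis using W[OF t] False by auto
  qed
  have \<alpha>: "0 < \<alpha>" "\<alpha> < 1/2"
  proof -
    have "1 \<le> real_of_int p" "2 * real_of_int p + 1 \<le> q" using p by linarith+
    then show "0 < \<alpha>" "\<alpha> < 1/2" using \<eta>(1) \<eta>4 q unfolding \<alpha>_def by (auto simp: field_simps)
  qed
  have U: "U t = (z t * p) div int q - (if int q dvd z t \<and> A (z t) < 0 then 1 else 0)" if "t \<le> n" for t
    using fl(1)[OF that] by (simp add: U_def)
  show ?thesis
  proof (intro exI[of _ U] conjI impI)
    show "crossings n W U"
      unfolding crossings_def
      by (intro exI[of _ \<alpha>] exI[of _ \<rho>] exI[of _ \<sigma>] conjI \<alpha> allI impI) (simp_all add: U_def fl W_eq)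
    have kqr: "real q \<le> real k * q" using kq by (simp flip: of_nat_mult)
    have pos: "\<not> real k * q + real q / 2 < 0" "\<not> real k * q + real q * 3 / 2 < 0"
      using kqr q(3) by linarith+
    \<comment> \<open>One stride before the first \<open>1\<close>, \<open>A\<close> is negative
      exactly if \<open>b\<close> holds, and one stride after the last \<open>1\<close> exactly if
      not; there the floor drops by the extra unit that records the drift.\<close>
    have neg: "\<not> A 0 < 0" "\<not> A (int q) < 0" "A (- int q) < 0 \<longleftrightarrow> b"
      "\<not> A (int q * int k) < 0" "A (int q * (int k + 1)) < 0 \<longleftrightarrow> \<not> b"
      using kqr pos q(3) by (auto simp: A_def algebra_simps)
    have Ui: "U i = 0" using U[of i] n neg by (simp add: z_def)
    have "U (i + q) = p" using U[of "i + q"] n kq neg q by (simp add: z_def)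
    then show "U (i + q) - U i = p" using Ui by simp
    show "U i - U (i - q) = p + (if b then 1 else 0)" if "q \<le> i"
    proof -
      have "z (i - q) = - int q" using that by (simp add: z_def)
      moreover have "(- int q * p) div int q = - p"
        using nonzero_mult_div_cancel_left[of "int q" "- p"] q by simp
      ultimately show ?thesis using U[of "i - q"] Ui n q neg by simp
    qed
    assume e: "i + k * q + q \<le> n"
    have z: "z (i + k * q) = int q * int k" "z (i + k * q + q) = int q * (int k + 1)"
      by (simp_all add: z_def algebra_simps)
    have "U (i + k * q) = int k * p"
      using U[of "i + k * q"] e q neg unfolding z by (simp add: mult.assoc)
    moreover have "U (i + k * q + q) = (int k + 1) * p - (if b then 0 else 1)"
      using U[of "i + k * q + q"] e q neg unfolding z by (simp add: mult.assoc)
    ultimately show "U (i + k * q + q) - U (i + k * q) = p - (if b then 0 else 1)"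
      by (simp add: algebra_simps)
  qed
qed

section \<open>Counting the admissible numbers of turns\<close>

text \<open>The reflection of \<open>p\<close> to \<open>q - p\<close> pairs the residues prime to
  \<open>q\<close>; its only possible fixed point q/2 is not prime to \<open>q\<close> once
  \<open>3 \<le> q\<close>.\<close>

lemma card_coprime_below_half:
  fixes q :: nat
  assumes "3 \<le> q"
  shows "2 * card {p. 0 < p \<and> 2 * p < q \<and> coprime p q} = totient q"
proof -
  let ?A = "{p. 0 < p \<and> 2 * p < q \<and> coprime p q}"
  have fin: "finite ?A" by (rule finite_subset[of _ "{..q}"]) auto
  have refl: "coprime (q - p) q \<longleftrightarrow> coprime p q" if "p \<le> q" for p
    using that by (metis coprime_iff_gcd_eq_1 gcd.commute gcd_diff2_nat)
  have "totatives q = ?A \<union> (\<lambda>p. q - p) ` ?A"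
  proof (intro set_eqI iffI)
    fix x assume "x \<in> totatives q"
    then have x: "0 < x" "x \<le> q" "coprime x q" by (auto simp: totatives_def)
    have "2 * x \<noteq> q"
    proof
      assume "2 * x = q"
      then have "x dvd q" by auto
      then have "x = 1" using x by (metis coprime_absorb_left nat_dvd_1_iff_1)
      then show False using \<open>2 * x = q\<close> assms by simp
    qed
    moreover have "x \<noteq> q" using x assms by auto
    ultimately show "x \<in> ?A \<union> (\<lambda>p. q - p) ` ?A"
      using x refl[of x] by (cases "2 * x < q") (auto intro!: image_eqI[of x _ "q - x"])
  next
    fix x assume "x \<in> ?A \<union> (\<lambda>p. q - p) ` ?A"
    then show "x \<in> totatives q" using refl by (auto simp: totatives_def)
  qed
  moreover have "?A \<inter> (\<lambda>p. q - p) ` ?A = {}" by auto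
  moreover have "card ((\<lambda>p. q - p) ` ?A) = card ?A"
    by (intro card_image inj_onI) auto
  ultimately show ?thesis using fin by (simp add: totient_def card_Un_disjoint)
qed

section \<open>From rotation words to floor functions\<close>

text \<open>The point \<open>x\<close> lies in the arc of length \<open>\<alpha>\<close> starting at
  \<open>\<beta>\<close> exactly if some integer \<open>m\<close> satisfies
  \<open>x - \<beta> - \<alpha> < m \<le> x - \<beta>\<close>; the difference of floors counts these
  integers.\<close>

lemma frac_in_circle_interval:
  fixes x \<beta> \<alpha> :: real
  assumes "0 \<le> \<beta>" "\<beta> < 1" "0 < \<alpha>" "\<alpha> < 1"
  shows "(if frac x \<in> circle_interval \<beta> (frac (\<beta> + \<alpha>)) then 1 else 0) = \<lfloor>x - \<beta>\<rfloor> - \<lfloor>x - \<beta> - \<alpha>\<rfloor>"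
proof -
  define m f where "m = \<lfloor>x\<rfloor>" and "f = frac x"
  have x: "x = of_int m + f" by (simp add: m_def f_def frac_def)
  have f: "0 \<le> f" "f < 1" by (auto simp: f_def frac_lt_1)
  have b: "frac (\<beta> + \<alpha>) = (if \<beta> + \<alpha> < 1 then \<beta> + \<alpha> else \<beta> + \<alpha> - 1)"
  proof (cases "\<beta> + \<alpha> < 1")
    case False
    then have "\<lfloor>\<beta> + \<alpha>\<rfloor> = 1" using assms by (intro floor_unique) auto
    then show ?thesis using False by (simp add: frac_def)
  qed (use assms in \<open>simp add: frac_eq\<close>)
  have fl: "\<lfloor>x - \<beta>\<rfloor> = (if \<beta> \<le> f then m else m - 1)"
    using f assms by (auto simp: x intro!: floor_unique)
  have fl2: "\<lfloor>x - \<beta> - \<alpha>\<rfloor> = (if \<beta> + \<alpha> \<le> f then m else if \<beta> + \<alpha> \<le> f + 1 then m - 1 else m - 2)"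
    using f assms by (auto simp: x intro!: floor_unique)
  show ?thesis
    unfolding fl fl2 f_def[symmetric] circle_interval_def b using f assms by auto
qed

definition mechanical :: "real \<Rightarrow> real \<Rightarrow> nat \<Rightarrow> int" where
  "mechanical \<alpha> \<rho> k = \<lfloor>real k * \<alpha> + \<rho>\<rfloor>"

lemma St_eq_mechanical:
  assumes "0 < \<alpha>" "\<alpha> < 1"
  shows "St n \<alpha> = range (\<lambda>\<rho>. increments n (mechanical \<alpha> \<rho>))"
proof -
  have rot: "rotation_word \<alpha> \<beta> (frac (\<beta> + \<alpha>)) n = increments n (mechanical \<alpha> (- \<alpha> - \<beta>))"
    if "\<beta> \<in> {0..<1}" for \<beta>
  proof -
    have "(if frac (real k * \<alpha>) \<in> circle_interval \<beta> (frac (\<beta> + \<alpha>)) then 1 else 0)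
        = mechanical \<alpha> (- \<alpha> - \<beta>) (Suc k) - mechanical \<alpha> (- \<alpha> - \<beta>) k" for k
      using frac_in_circle_interval[of \<beta> \<alpha> "real k * \<alpha>"] that assms
      by (simp add: mechanical_def algebra_simps)
    then show ?thesis by (simp add: rotation_word_def increments_def)
  qed
  show ?thesis
  proof (intro set_eqI iffI)
    fix u assume "u \<in> St n \<alpha>"
    then show "u \<in> range (\<lambda>\<rho>. increments n (mechanical \<alpha> \<rho>))" using rot by (auto simp: St_def)
  next
    fix u assume "u \<in> range (\<lambda>\<rho>. increments n (mechanical \<alpha> \<rho>))"
    then obtain \<rho> where u: "u = increments n (mechanical \<alpha> \<rho>)" by auto
    \<comment> \<open>Then \<open>- \<alpha> - \<beta>\<close> agrees with \<open>\<rho>\<close>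
      modulo one, and integer shifts of the intercept do not change increments.\<close>
    define \<beta> where "\<beta> = frac (- \<alpha> - \<rho>)"
    have \<beta>: "\<beta> \<in> {0..<1}" by (simp add: \<beta>_def frac_lt_1)
    have "\<rho> = - \<alpha> - \<beta> + of_int (- \<lfloor>- \<alpha> - \<rho>\<rfloor>)" by (simp add: \<beta>_def frac_def)
    then have "mechanical \<alpha> \<rho> k = mechanical \<alpha> (- \<alpha> - \<beta>) k + (- \<lfloor>- \<alpha> - \<rho>\<rfloor>)" for k
      unfolding mechanical_def by (metis add.assoc floor_add_int)
    then have "u = increments n (mechanical \<alpha> (- \<alpha> - \<beta>))" by (simp add: u increments_def)
    then have "u = rotation_word \<alpha> \<beta> (frac (\<beta> + \<alpha>)) n" using rot[OF \<beta>] by simp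
    then show "u \<in> St n \<alpha>" unfolding St_def using \<beta> by blast
  qed
qed

lemma generating_pairs_eq_crossings:
  assumes len: "length w = n + 1" and bin: "binary_word w"
  shows "generating_pairs n w =
    (\<lambda>U. (increments n U, increments n (\<lambda>k. U k - w ! k))) ` {U. crossings n ((!) w) U}"
proof (intro set_eqI iffI)
  fix x assume x: "x \<in> generating_pairs n w"
  obtain u v where uv: "x = (u, v)" by force
  from x uv obtain \<alpha> where \<alpha>: "0 < \<alpha>" "\<alpha> < 1/2" "u \<in> St n \<alpha>" "v \<in> St n \<alpha>"
    by (auto simp: generating_pairs_def sturmian_pairs_def)
  then obtain \<rho> \<sigma> where u: "u = increments n (mechanical \<alpha> \<rho>)" and v: "v = increments n (mechanical \<alpha> \<sigma>)"
    using St_eq_mechanical[of \<alpha> n] by auto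
  let ?P = "mechanical \<alpha> \<rho>" and ?Q = "mechanical \<alpha> \<sigma>"
  have step: "w ! Suc k = w ! k + (?P (Suc k) - ?P k) - (?Q (Suc k) - ?Q k)" if "k < n" for k
  proof -
    have "Suc k \<in> {1..n}" using that by simp
    then have "w ! Suc k = w ! (Suc k - 1) + u ! (Suc k - 1) - v ! (Suc k - 1)"
      using x unfolding uv generating_pairs_def generates_def by blast
    then show ?thesis using that by (simp add: u v increments_def)
  qed
  \<comment> \<open>The prefix sums yield \<open>w\<close> only up to this constant, which is
    absorbed into \<open>\<sigma>\<close>.\<close>
  define c where "c = ?P 0 - ?Q 0 - w ! 0"
  have wk: "w ! k = ?P k - ?Q k - c" if "k \<le> n" for k
    using that by (induction k) (auto simp: c_def step)
  have "crossings n ((!) w) ?P"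
    unfolding crossings_def
    by (rule exI[of _ \<alpha>], rule exI[of _ \<rho>], rule exI[of _ "\<sigma> + of_int c"])
       (use \<alpha> wk in \<open>auto simp: mechanical_def simp flip: add.assoc\<close>)
  moreover have "v = increments n (\<lambda>k. ?P k - w ! k)"
    by (auto simp: v increments_def wk)
  ultimately show "x \<in> (\<lambda>U. (increments n U, increments n (\<lambda>k. U k - w ! k))) ` {U. crossings n ((!) w) U}"
    using uv u by blast
next
  fix x assume "x \<in> (\<lambda>U. (increments n U, increments n (\<lambda>k. U k - w ! k))) ` {U. crossings n ((!) w) U}"
  then obtain U where U: "crossings n ((!) w) U"
    and x: "x = (increments n U, increments n (\<lambda>k. U k - w ! k))" by auto
  then obtain \<alpha> \<rho> \<sigma> :: real where \<alpha>: "0 < \<alpha>" "\<alpha> < 1/2"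
    and f: "\<And>k. k \<le> n \<Longrightarrow> U k = mechanical \<alpha> \<rho> k" "\<And>k. k \<le> n \<Longrightarrow> U k - w ! k = mechanical \<alpha> \<sigma> k"
    unfolding crossings_def mechanical_def by metis
  have "increments n U = increments n (mechanical \<alpha> \<rho>)"
    unfolding increments_def by (intro map_cong) (simp_all add: f(1))
  moreover have "increments n (\<lambda>k. U k - w ! k) = increments n (mechanical \<alpha> \<sigma>)"
    unfolding increments_def by (intro map_cong) (simp_all add: f(2))
  ultimately have "increments n U \<in> St n \<alpha>" "increments n (\<lambda>k. U k - w ! k) \<in> St n \<alpha>"
    using St_eq_mechanical[of \<alpha> n] \<alpha> by auto
  then have "x \<in> sturmian_pairs n" using \<alpha> by (auto simp: x sturmian_pairs_def)
  moreover have "generates n x w"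
    using len bin by (auto simp: x generates_def increments_def)
  ultimately show "x \<in> generating_pairs n w" by (simp add: generating_pairs_def)
qed

lemma increments_eq_iff:
  "increments n U = increments n U' \<longleftrightarrow> (\<forall>t\<le>n. U t - U' t = U 0 - U' 0)"
proof
  assume e: "increments n U = increments n U'"
  have step: "U (Suc k) - U k = U' (Suc k) - U' k" if "k < n" for k
    using arg_cong[OF e, of "\<lambda>l. l ! k"] that by (simp add: increments_def)
  have "U t - U' t = U 0 - U' 0" if "t \<le> n" for t
    using that
  proof (induction t)
    case (Suc t)
    then show ?case using step[of t] by simp
  qed simp
  then show "\<forall>t\<le>n. U t - U' t = U 0 - U' 0" by blast
next
  assume a: "\<forall>t\<le>n. U t - U' t = U 0 - U' 0"
  have "U (Suc k) - U k = U' (Suc k) - U' k" if "k < n" for k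
    using a[rule_format, of k] a[rule_format, of "Suc k"] that by simp
  then show "increments n U = increments n U'" by (simp add: increments_def)
qed

lemma increments_pair_eq_iff:
  "(increments n U, increments n (\<lambda>k. U k - W k)) = (increments n U', increments n (\<lambda>k. U' k - W k))
    \<longleftrightarrow> (\<forall>t\<le>n. U t - U' t = U 0 - U' 0)"
  by (auto simp: increments_eq_iff)

section \<open>Periodic words and the number of their pairs\<close>

lemma word_power_singleton: "word_power [x] k = replicate k x"
  by (induction k) (auto simp: word_power_def)

text \<open>Behind the first \<open>y\<close> the word has the same shape with initial run
  \<open>l\<close> and one period less. The induction on \<open>k\<close> therefore has to let
  \<open>i\<close> vary.\<close>

lemma periodic_word_nth:
  fixes x y :: int and l j :: nat
  defines "F \<equiv> \<lambda>i k. word_power [x] i @ word_power ([y] @ word_power [x] l) k @ [y] @ word_power [x] j"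
  shows "length (F i k) = i + k * Suc l + 1 + j"
    and "t < i + k * Suc l + 1 + j \<Longrightarrow> F i k ! t = (if \<exists>c\<le>k. t = i + c * Suc l then y else x)"
proof -
  have F_Suc: "F i (Suc k) = replicate i x @ [y] @ F l k" for i k
    by (simp add: F_def word_power_singleton) (simp add: word_power_def)
  have zero: "F i 0 = replicate i x @ [y] @ replicate j x" for i
    by (simp add: F_def word_power_singleton) (simp add: word_power_def)
  show len: "length (F i k) = i + k * Suc l + 1 + j" for i k
    by (induction k arbitrary: i) (simp_all add: F_Suc zero)
  show "t < i + k * Suc l + 1 + j \<Longrightarrow> F i k ! t = (if \<exists>c\<le>k. t = i + c * Suc l then y else x)"
  proof (induction k arbitrary: i t)
    case 0
    then show ?case by (auto simp: zero nth_append nth_Cons split: nat.splits)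
  next
    case (Suc k)
    consider "t < i" | "t = i" | "i < t" by linarith
    then show ?case
    proof cases
      case 3
      then obtain d where d: "t = i + Suc d" using less_iff_Suc_add by auto
      then have "F i (Suc k) ! t = F l k ! (t - i - 1)"
        by (simp add: F_Suc nth_append)
      also have "\<dots> = (if \<exists>c\<le>k. t - i - 1 = l + c * Suc l then y else x)"
        using Suc.prems 3 by (intro Suc.IH) auto
      also have "(\<exists>c\<le>k. t - i - 1 = l + c * Suc l) \<longleftrightarrow> (\<exists>c\<le>Suc k. t = i + c * Suc l)"
      proof
        assume "\<exists>c\<le>k. t - i - 1 = l + c * Suc l"
        then obtain c where "c \<le> k" "t - i - 1 = l + c * Suc l" by blast
        then show "\<exists>c\<le>Suc k. t = i + c * Suc l" using 3 by (intro exI[of _ "Suc c"]) auto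
      next
        assume "\<exists>c\<le>Suc k. t = i + c * Suc l"
        then obtain c where c: "c \<le> Suc k" "t = i + c * Suc l" by blast
        then obtain d where "c = Suc d" using 3 by (cases c) auto
        then show "\<exists>c\<le>k. t - i - 1 = l + c * Suc l" using c by (intro exI[of _ d]) auto
      qed
      finally show ?thesis .
    qed (auto simp: F_Suc nth_append)
  qed
qed

lemma binary_word_nth: "binary_word w \<Longrightarrow> t < length w \<Longrightarrow> w ! t = 0 \<or> w ! t = 1"
  using nth_mem[of t w] unfolding binary_word_def by blast

lemma two_ones_consecutive:
  assumes len: "length w = n + 1" and bin: "binary_word w" and two: "2 \<le> count_list w 1"
  obtains s q where "consecutive n ((!) w) s q"
proof -
  let ?A = "{t. t < length w \<and> w ! t = 1}"
  have "count_list w 1 = card {t. t < length w \<and> 1 = w ! t}"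
    by (simp add: count_list_eq_length_filter length_filter_conv_card)
  also have "{t. t < length w \<and> 1 = w ! t} = ?A" by auto
  finally have "count_list w 1 = card ?A" .
  then have "\<not> card ?A \<le> Suc 0" using two by simp
  moreover have "finite ?A" by simp
  ultimately obtain x y where xy: "x \<in> ?A" "y \<in> ?A" "x \<noteq> y"
    using card_le_Suc0_iff_eq[of ?A] by blast
  then obtain a b where "a \<in> ?A" "b \<in> ?A" "a < b"
    by (cases x y rule: linorder_cases) auto
  then have ab: "w ! a = 1" "w ! b = 1" "a < b" "b \<le> n" using len by auto
  have "w ! t = 0 \<or> w ! t = 1" if "t \<le> n" for t
    using binary_word_nth[OF bin] len that by simp
  then show ?thesis using consecutive_around[of "(!) w" a b b n] ab that by blast
qed

text \<open>Two different pairs rule out unequal gaps. For equal gaps the pairs correspond to the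
  choices of a number of turns in \<open>A\<close> and a visible direction of drift in
  \<open>S\<close>.\<close>

lemma generating_pairs_no_11:
  fixes w :: "int list"
  assumes len: "length w = n + 1" and bin: "binary_word w"
    and two: "2 \<le> count_list w 1"
    and no11: "\<And>t. t < n \<Longrightarrow> \<not> (w ! t = 1 \<and> w ! Suc t = 1)"
    and pairs: "P \<in> generating_pairs n w" "P' \<in> generating_pairs n w" "P \<noteq> P'"
  shows "\<exists>i j l k :: nat. l \<ge> 2 \<and> k \<ge> 1 \<and>
    w = word_power [0] i @ word_power ([1] @ word_power [0] l) k @ [1] @ word_power [0] j \<and>
    finite (generating_pairs n w) \<and>
    real (card (generating_pairs n w)) =
      (if i \<le> l \<and> j \<le> l then real (totient (l + 1)) / 2 else real (totient (l + 1)))"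
proof -
  let ?W = "(!) w"
  define code where "code U = (increments n U, increments n (\<lambda>k. U k - w ! k))" for U
  have gp: "generating_pairs n w = code ` {U. crossings n ?W U}"
    unfolding code_def by (rule generating_pairs_eq_crossings[OF len bin])
  have code_eq: "code U = code U' \<longleftrightarrow> (\<forall>t\<le>n. U t - U' t = U 0 - U' 0)" for U U'
    unfolding code_def by (rule increments_pair_eq_iff)
  obtain V V' where V: "crossings n ?W V" "crossings n ?W V'" "code V \<noteq> code V'"
    using pairs unfolding gp by auto
  have W01: "w ! t = 0 \<or> w ! t = 1" if "t \<le> n" for t
    using binary_word_nth[OF bin] len that by simp
  obtain s0 q where c0: "consecutive n ?W s0 q" using two_ones_consecutive[OF len bin two] .
  have gaps: "r = q" if "consecutive n ?W s r" for s r
  proof (rule ccontr)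
    assume "r \<noteq> q"
    then have "\<forall>t\<le>n. V t - V' t = V 0 - V' 0"
      using crossings_rigid_unequal_gaps[OF V(1,2) W01 no11 that c0] by blast
    then show False using V(3) code_eq by blast
  qed
  obtain i k where k: "1 \<le> k" and ikn: "i + k * q \<le> n"
    and "\<forall>t\<le>n. w ! t = (if \<exists>c\<le>k. t = i + c * q then 1 else 0)"
    by (rule equal_gaps_progression[OF W01 c0 gaps])
  then have W: "w ! t = (if \<exists>c\<le>k. t = i + c * q then 1 else 0)" if "t \<le> n" for t
    using that by blast
  have kq: "q \<le> k * q" using k by simp
  have q0: "0 < q" using c0 by (simp add: consecutive_def)
  have q2: "2 \<le> q" using c0 no11[of s0] by (cases "q = 1") (auto simp: consecutive_def)
  have ci: "consecutive n ?W i q"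
    using progression_consecutive[OF W q0 ikn, of 0] k by simp
  then have i1: "i + q \<le> n" "w ! i = 1" "w ! (i + q) = 1" by (auto simp: consecutive_def)
  have last: "w ! (i + k * q) = 1" using W[OF ikn] by auto
  have before: "w ! (i - q) = 0" if "q \<le> i"
  proof -
    have "i - q \<noteq> i + c * q" for c using that q0 by linarith
    then show ?thesis using W[of "i - q"] i1 by simp
  qed
  have after: "w ! (i + k * q + q) = 0" if "i + k * q + q \<le> n"
  proof -
    have "i + k * q + q \<noteq> i + c * q" if "c \<le> k" for c
      using mult_le_mono1[OF that, of q] q0 by linarith
    then show ?thesis using W[OF that] by auto
  qed
  have entry: "U i - U (i - q) \<in> {U (i + q) - U i, U (i + q) - U i + 1}"
    if "crossings n ?W U" "q \<le> i" for U
    using crossings_entry[OF that(1) i1, of "i - q"] before that(2) i1 by simp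
  have exit: "U (i + k * q + q) - U (i + k * q) \<in> {U (i + q) - U i - 1, U (i + q) - U i}"
    if "crossings n ?W U" "i + k * q + q \<le> n" for U
    by (rule crossings_exit[OF that(1) i1 that(2) last after[OF that(2)]])
  have entry_exit: "U i - U (i - q) = U (i + k * q + q) - U (i + k * q) + 1"
    if "crossings n ?W U" "q \<le> i" "i + k * q + q \<le> n" for U
    using crossings_entry_exit[OF that(1) _ _ _ that(3) last after[OF that(3)], of "i - q"] before that i1 by simp
  have bounds: "0 < U (i + q) - U i" "2 * (U (i + q) - U i) \<le> int q"
    "3 \<le> q \<Longrightarrow> 2 * (U (i + q) - U i) < int q" "coprime (U (i + q) - U i) (int q)"
    if "crossings n ?W U" for U
    using crossings_consecutive_bounds[OF that ci q2] crossings_consecutive_coprime[OF that ci] by auto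
  have rigid: "code U = code U'" if "crossings n ?W U" "crossings n ?W U'"
    "U (i + q) - U i = U' (i + q) - U' i"
    "q \<le> i \<Longrightarrow> U i - U (i - q) = U' i - U' (i - q)"
    "i + k * q + q \<le> n \<Longrightarrow> U (i + k * q + q) - U (i + k * q) = U' (i + k * q + q) - U' (i + k * q)" for U U'
    unfolding code_eq using crossings_rigid_equal_gaps[OF that(1,2) W k q2 ikn that(3-5)] by blast
  \<comment> \<open>For \<open>q = 2\<close> the number of turns is \<open>1\<close>, and
    \<open>\<alpha> < 1/2\<close> fixes the entry at \<open>1\<close> and the exit at
    \<open>0\<close>; the pair would be unique.\<close>
  have "q \<noteq> 2"
  proof
    assume q: "q = 2"
    have one: "U (i + q) - U i = 1" if "crossings n ?W U" for U
      using bounds(1,2)[OF that] by (simp add: q)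
    have en: "U i - U (i - q) = 1" if "crossings n ?W U" "q \<le> i" for U
    proof -
      have e: "i - q + 2 = i" and "i \<le> n" using that(2) q i1(1) by auto
      then have "U i - U (i - q) \<le> 1"
        using crossings_two_steps(1)[OF that(1), of "i - q"] unfolding e by blast
      then show ?thesis using entry[OF that] one[OF that(1)] by auto
    qed
    have ex: "U (i + k * q + q) - U (i + k * q) = 0" if "crossings n ?W U" "i + k * q + q \<le> n" for U
    proof -
      have "U (i + k * q + q) \<le> U (i + k * q)"
        using crossings_two_steps(2)[OF that(1), of "i + k * q"] last after that(2) unfolding q by blast
      then show ?thesis using exit[OF that] one[OF that(1)] by auto
    qed
    have "code V = code V'"
      by (rule rigid[OF V(1,2)]) (simp_all add: one[OF V(1)] one[OF V(2)] en[OF V(1)] en[OF V(2)] ex[OF V(1)] ex[OF V(2)])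
    then show False using V(3) by simp
  qed
  then have q3: "3 \<le> q" using q2 by simp
  \<comment> \<open>Since \<open>l = q - 1\<close>, \<open>q \<le> i\<close> is the negation of
    \<open>i \<le> l\<close>, and likewise for \<open>j\<close>.\<close>
  define l j where "l = q - 1" and "j = n - (i + k * q)"
  have l: "q = Suc l" "2 \<le> l" using q3 by (auto simp: l_def)
  have j: "n = i + k * q + j" using ikn by (simp add: j_def)

  define A where "A = {p. 0 < p \<and> 2 * p < q \<and> coprime p q}"
  \<comment> \<open>Without room for an entry or an exit both directions give the same pair,
    represented by \<open>True\<close>.\<close>
  define S where "S = (if q \<le> i \<or> q \<le> j then {True, False} else {True})"
  define good where "good p b U \<longleftrightarrow> crossings n ?W U \<and> U (i + q) - U i = int p \<and>
    (q \<le> i \<longrightarrow> U i - U (i - q) = int p + (if b then 1 else 0)) \<and>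
    (i + k * q + q \<le> n \<longrightarrow> U (i + k * q + q) - U (i + k * q) = int p - (if b then 0 else 1))"
    for p :: nat and b U
  \<comment> \<open>Any choice will do: by \<open>rigid\<close>, all \<open>U\<close> that are good
    for the same \<open>p\<close> and \<open>b\<close> have the same code.\<close>
  define G where "G x = (SOME U. good (fst x) (snd x) U)" for x
  have G: "good (fst x) (snd x) (G x)" if "x \<in> A \<times> S" for x
  proof -
    have p: "0 < int (fst x)" "2 * int (fst x) < int q" "coprime (int (fst x)) (int q)"
      using that by (auto simp: A_def)
    have "\<exists>U. good (fst x) (snd x) U"
      unfolding good_def by (rule crossings_exists[OF W k ikn p])
    then show ?thesis unfolding G_def by (rule someI_ex)
  qed
  have image: "generating_pairs n w = (\<lambda>x. code (G x)) ` (A \<times> S)"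
  proof (intro set_eqI iffI)
    fix x assume "x \<in> generating_pairs n w"
    then obtain U where U: "crossings n ?W U" "x = code U" unfolding gp by auto
    define p where "p = nat (U (i + q) - U i)"
    \<comment> \<open>The direction is read off the entry if there is one, else off the exit. If
      both exist, \<open>entry_exit\<close> makes the readings agree.\<close>
    define b where "b \<longleftrightarrow> (if q \<le> i then U i - U (i - q) = int p + 1
      else if q \<le> j then U (i + k * q + q) - U (i + k * q) = int p else True)"
    have p: "int p = U (i + q) - U i" using bounds(1)[OF U(1)] by (simp add: p_def)
    have "p \<in> A" using bounds[OF U(1)] q3 unfolding A_def p[symmetric] by simp
    moreover have "b \<in> S" by (auto simp: S_def b_def)
    moreover have g: "good p b U"
      unfolding good_def using U(1) p entry[OF U(1)] exit[OF U(1)] entry_exit[OF U(1)] j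
      by (auto simp: b_def)
    ultimately have x: "(p, b) \<in> A \<times> S" by simp
    have "code U = code (G (p, b))"
      by (rule rigid) (use g G[OF x] in \<open>auto simp: good_def\<close>)
    then show "x \<in> (\<lambda>x. code (G x)) ` (A \<times> S)" using x U(2) by blast
  next
    fix x assume "x \<in> (\<lambda>x. code (G x)) ` (A \<times> S)"
    then show "x \<in> generating_pairs n w" using G unfolding gp good_def by blast
  qed
  have "inj_on (\<lambda>x. code (G x)) (A \<times> S)"
  proof (rule inj_onI)
    fix x y assume x: "x \<in> A \<times> S" and y: "y \<in> A \<times> S" and "code (G x) = code (G y)"
    then have e: "G x t - G y t = G x 0 - G y 0" if "t \<le> n" for t
      using code_eq that by blast
    \<comment> \<open>Equal codes have equal increments over any stretch; these return
      \<open>p\<close> and, if visible, the direction.\<close>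
    have ed: "G x t - G x s = G y t - G y s" if "t \<le> n" "s \<le> n" for s t
      using e[OF that(1)] e[OF that(2)] by simp
    note gx = G[OF x, unfolded good_def] and gy = G[OF y, unfolded good_def]
    have "int (fst x) = int (fst y)" using gx gy ed[of "i + q" i] i1 by simp
    then have f: "fst x = fst y" by simp
    have "snd x = snd y"
    proof (cases "q \<le> i \<or> q \<le> j")
      case True
      then show ?thesis
      proof
        assume "q \<le> i"
        then show ?thesis using gx gy f ed[of i "i - q"] i1 by (auto split: if_splits)
      next
        assume "q \<le> j"
        then have "i + k * q + q \<le> n" using j by simp
        then show ?thesis using gx gy f ed[of "i + k * q + q" "i + k * q"] by (auto split: if_splits)
      qed
    qed (use x y in \<open>auto simp: S_def\<close>)
    with f show "x = y" by (simp add: prod_eq_iff)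
  qed
  then have card: "card (generating_pairs n w) = card A * card S"
    by (simp add: image card_image card_cartesian_product)
  have "finite A" unfolding A_def by (rule finite_subset[of _ "{..q}"]) auto
  then have fin: "finite (generating_pairs n w)"
    by (simp add: image S_def)
  have tot: "totient (l + 1) = 2 * card A"
    using card_coprime_below_half[OF q3] by (simp add: A_def l)
  have cardS: "card S = (if i \<le> l \<and> j \<le> l then 1 else 2)"
    using l by (auto simp: S_def)
  have "w = word_power [0] i @ word_power ([1] @ word_power [0] l) k @ [1] @ word_power [0] j" (is "w = ?F")
  proof (rule nth_equalityI)
    show "length w = length ?F"
      using periodic_word_nth(1)[of 0 i 1 l k j] len j l by simp
    fix t assume "t < length w"
    then show "w ! t = ?F ! t"
      using periodic_word_nth(2)[of t i k l j 0 1] W[of t] len j l by simp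
  qed
  moreover have "real (card (generating_pairs n w)) =
      (if i \<le> l \<and> j \<le> l then real (totient (l + 1)) / 2 else real (totient (l + 1)))"
    unfolding card cardS tot by simp
  ultimately show ?thesis using l(2) k fin by blast
qed

section \<open>Complementation and the general case\<close>

text \<open>Complementing \<open>w\<close> changes the sign of its steps \<open>u - v\<close>, so
  the two words trade places. One inclusion suffices, because complementing twice restores the
  word.\<close>

lemma generating_pairs_complement:
  "generating_pairs n (map (\<lambda>x. 1 - x) w) = prod.swap ` generating_pairs n w"
proof -
  have le: "prod.swap p \<in> generating_pairs n (map (\<lambda>x. 1 - x) w)" if "p \<in> generating_pairs n w" for p w
    using that by (cases p) (auto simp: generating_pairs_def sturmian_pairs_def generates_def binary_word_def)
  show ?thesis
  proof (intro set_eqI iffI)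
    fix x assume "x \<in> generating_pairs n (map (\<lambda>x. 1 - x) w)"
    from le[OF this] have "prod.swap x \<in> generating_pairs n w" by (simp add: comp_def)
    then show "x \<in> prod.swap ` generating_pairs n w" by (metis image_eqI swap_swap)
  qed (use le in auto)
qed

lemma count_list_complement: "count_list (map (\<lambda>x. 1 - x) w) 1 = count_list (w :: int list) 0"
  by (induction w) auto

lemma map_word_power: "map f (word_power x k) = word_power (map f x) k"
  by (simp add: word_power_def map_concat)

theorem theorem2:
  fixes w :: "int list" and n :: nat
  assumes "binary_rotation_word w"
    and "length w = n + 1"
    and "count_list w 1 \<ge> 2"
    and "count_list w 0 \<ge> 2"
    and "\<exists>p\<in>generating_pairs n w. \<exists>q\<in>generating_pairs n w. p \<noteq> q"
  shows "\<exists>i j l k :: nat. l \<ge> 2 \<and> k \<ge> 1 \<and>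
    (w = word_power [0] i @ word_power ([1] @ word_power [0] l) k @ [1] @ word_power [0] j \<or>
     w = word_power [1] i @ word_power ([0] @ word_power [1] l) k @ [0] @ word_power [1] j) \<and>
    finite (generating_pairs n w) \<and>
    real (card (generating_pairs n w)) =
      (if i \<le> l \<and> j \<le> l then real (totient (l + 1)) / 2 else real (totient (l + 1)))"
proof -
  obtain P P' where P: "P \<in> generating_pairs n w" "P' \<in> generating_pairs n w" "P \<noteq> P'"
    using assms(5) by blast
  then have bin: "binary_word w" by (auto simp: generating_pairs_def generates_def)
  have W01: "w ! t = 0 \<or> w ! t = 1" if "t \<le> n" for t
    using binary_word_nth[OF bin] assms(2) that by simp
  have "\<not> ((\<exists>s<n. w ! s = 1 \<and> w ! Suc s = 1) \<and> (\<exists>z<n. w ! z = 0 \<and> w ! Suc z = 0))"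
  proof
    assume "(\<exists>s<n. w ! s = 1 \<and> w ! Suc s = 1) \<and> (\<exists>z<n. w ! z = 0 \<and> w ! Suc z = 0)"
    then obtain s z where s: "s < n" "w ! s = 1" "w ! Suc s = 1" and z: "z < n" "w ! z = 0" "w ! Suc z = 0"
      by blast
    obtain U U' where U: "crossings n ((!) w) U" "crossings n ((!) w) U'"
      and PU: "P = (increments n U, increments n (\<lambda>k. U k - w ! k))"
        "P' = (increments n U', increments n (\<lambda>k. U' k - w ! k))"
      using P unfolding generating_pairs_eq_crossings[OF assms(2) bin] by blast
    have "U t - U' t = U 0 - U' 0" if "t \<le> n" for t
      by (rule crossings_rigid_00_11[OF U W01 s z that])
    then show False using P(3) unfolding PU increments_pair_eq_iff by blast
  qed
  then have "(\<forall>t<n. \<not> (w ! t = 1 \<and> w ! Suc t = 1)) \<or> (\<forall>t<n. \<not> (w ! t = 0 \<and> w ! Suc t = 0))"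
    by blast
  then consider "\<And>t. t < n \<Longrightarrow> \<not> (w ! t = 1 \<and> w ! Suc t = 1)"
    | "\<And>t. t < n \<Longrightarrow> \<not> (w ! t = 0 \<and> w ! Suc t = 0)" by blast
  then show ?thesis
  proof cases
    case 1
    show ?thesis
      using generating_pairs_no_11[OF assms(2) bin assms(3) 1 P] by blast
  next
    case 2
    \<comment> \<open>Complementation turns the absence of \<open>00\<close> into that of
      \<open>11\<close>, and the swap keeps the number of pairs.\<close>
    define w' where "w' = map (\<lambda>x. 1 - x) w"
    have w: "w = map (\<lambda>x. 1 - x) w'" by (simp add: w'_def comp_def)
    have gp: "generating_pairs n w' = prod.swap ` generating_pairs n w"
      unfolding w'_def by (rule generating_pairs_complement)
    have len: "length w' = n + 1" using assms(2) by (simp add: w'_def)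
    have bin': "binary_word w'" using bin by (auto simp: w'_def binary_word_def)
    have two: "2 \<le> count_list w' 1" using assms(4) by (simp add: w'_def count_list_complement)
    have no11: "\<not> (w' ! t = 1 \<and> w' ! Suc t = 1)" if "t < n" for t
      using 2[OF that] assms(2) that by (simp add: w'_def)
    have P': "prod.swap P \<in> generating_pairs n w'" "prod.swap P' \<in> generating_pairs n w'"
      "prod.swap P \<noteq> prod.swap P'"
      using P by (simp_all add: gp) (metis swap_swap)
    have card: "card (generating_pairs n w') = card (generating_pairs n w)"
      and fin: "finite (generating_pairs n w') \<longleftrightarrow> finite (generating_pairs n w)"
      unfolding gp by (auto intro!: card_image dest: finite_imageD)
    from generating_pairs_no_11[OF len bin' two no11 P'] obtain i j l k where
      *: "2 \<le> l" "1 \<le> k"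
      "w' = word_power [0] i @ word_power ([1] @ word_power [0] l) k @ [1] @ word_power [0] j"
      "finite (generating_pairs n w)"
      "real (card (generating_pairs n w)) =
        (if i \<le> l \<and> j \<le> l then real (totient (l + 1)) / 2 else real (totient (l + 1)))"
      unfolding card fin by blast
    have "w = word_power [1] i @ word_power ([0] @ word_power [1] l) k @ [0] @ word_power [1] j"
      unfolding w *(3) by (simp add: map_word_power)
    then show ?thesis using * by blast
  qed
qed

end
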